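(* Let $\ell,T>0$, $N\in\mathbb{N}$, $\sigma\in\mathbb{C}\setminus\{0\}$ and $P,Q\in (C^1[0,\ell])^{N\times N}$. For $1\le k\le N$ let $u^k=(u^k_1,\dots,u^k_N)^T$ and $\widetilde{u}^k=(\widetilde{u}^k_1,\dots,\widetilde{u}^k_N)^T$ belong to $(C^{1,2}([0,T]\times[0,\ell]))^N$ and satisfy $$\sigma\partial_t u^k=\partial_x^2u^k-P(x)u^k\ \text{ on }[0,T]\times[0,\ell],\qquad \partial_xu^k(t,0)=0\ \text{ for }t\in(0,T),$$ $$\sigma\partial_t \widetilde{u}^k=\partial_x^2\widetilde{u}^k-Q(x)\widetilde{u}^k\ \text{ on }[0,T]\times[0,\ell],\qquad \partial_x\widetilde{u}^k(t,0)=0\ \text{ for }t\in(0,T).$$ Case 1 (spatial data at $t=0$). Assume $|\det(u^1(0,x)\ \cdots\ u^N(0,x))|>0$ for all $x\in[0,\ell]$. If $u^k(0,x)=\widetilde{u}^k(0,x)$ for all $x\in(0,\ell)$ and all $k\in\{1,\dots,N\}$, and $u^k(t,0)=\widetilde{u}^k(t,0)$ for all $0<t<T$ and all $k\in\{1,\dots,N\}$, then $P=Q$ on $[0,\ell]$. Case 2 (spatial data at $t=T$). Assume $|\det(u^1(T,x)\ \cdots\ u^N(T,x))|>0$ for all $x\in[0,\ell]$. If $u^k(T,x)=\widetilde{u}^k(T,x)$ for all $x\in(0,\ell)$ and all $k\in\{1,\dots,N\}$, and $u^k(t,0)=\widetilde{u}^k(t,0)$ for all $0<t<T$ and all $k\in\{1,\dots,N\}$,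 then $P=Q$ on $[0,\ell]$.
   Context: $C^{1,2}([0,T]\times[0,\ell])$ denotes the set of $u\in C([0,T]\times[0,\ell])$ such that $\partial_tu,\partial_xu,\partial_x^2u\in C([0,T]\times[0,\ell])$. $(u^1\ \cdots\ u^N)$ denotes the $N\times N$ matrix whose columns are the vectors $u^1,\dots,u^N$. The matrices $P,Q$ are not assumed symmetric. Functions may be complex-valued. *)

theory Defs
  imports "HOL-Analysis.Analysis"
begin

text \<open>
  Function spaces on closed intervals and rectangles. All derivatives are taken within the closed
  interval, i.e. they are one-sided at the end points, so that the notions depend only on the
  values of the function on the closed domain. This is why \<open>C1_differentiable_on\<close>, which uses
  two-sided derivatives, is not used.
\<close>

definition C1_interval :: "real \<Rightarrow> (real \<Rightarrow> 'a::real_normed_vector) \<Rightarrow> bool" where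
  "C1_interval l f \<longleftrightarrow>
     (\<forall>x\<in>{0..l}. f differentiable (at x within {0..l})) \<and>
     continuous_on {0..l} (\<lambda>x. vector_derivative f (at x within {0..l}))"

definition partial_t ::
  "real \<Rightarrow> (real \<Rightarrow> real \<Rightarrow> 'a::real_normed_vector) \<Rightarrow> real \<Rightarrow> real \<Rightarrow> 'a" where
  "partial_t T u t x = vector_derivative (\<lambda>s. u s x) (at t within {0..T})"

definition partial_x ::
  "real \<Rightarrow> (real \<Rightarrow> real \<Rightarrow> 'a::real_normed_vector) \<Rightarrow> real \<Rightarrow> real \<Rightarrow> 'a" where
  "partial_x l u t x = vector_derivative (\<lambda>y. u t y) (at x within {0..l})"

text \<open>
  Since \<open>vector_derivative\<close> is total, the existence of the partial derivatives is required
  explicitly in addition to their continuity.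
\<close>

definition C12_rectangle ::
  "real \<Rightarrow> real \<Rightarrow> (real \<Rightarrow> real \<Rightarrow> 'a::real_normed_vector) \<Rightarrow> bool" where
  "C12_rectangle T l u \<longleftrightarrow>
     (\<forall>t\<in>{0..T}. \<forall>x\<in>{0..l}.
        (\<lambda>s. u s x) differentiable (at t within {0..T}) \<and>
        (\<lambda>y. u t y) differentiable (at x within {0..l}) \<and>
        (\<lambda>y. partial_x l u t y) differentiable (at x within {0..l})) \<and>
     continuous_on ({0..T} \<times> {0..l}) (\<lambda>(t, x). u t x) \<and>
     continuous_on ({0..T} \<times> {0..l}) (\<lambda>(t, x). partial_t T u t x) \<and>
     continuous_on ({0..T} \<times> {0..l}) (\<lambda>(t, x). partial_x l u t x) \<and>
     continuous_on ({0..T} \<times> {0..l}) (\<lambda>(t, x). partial_x l (partial_x l u) t x)"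

definition matrix_of_columns :: "('n \<Rightarrow> 'a ^ 'n) \<Rightarrow> 'a ^ 'n ^ 'n" where
  "matrix_of_columns v = (\<chi> i k. v k $ i)"

end

theory Submission imports Defs begin

text \<open>
  Extend \<open>P\<close> and the solutions evenly in \<open>x\<close>. For a family of functionals \<open>K x\<close> solving a Volterra
  equation, \<open>f x + K x f\<close> turns solutions of the system with \<open>P\<close> satisfying the Neumann condition into
  solutions of the system with \<open>Q\<close> having the same Cauchy data at \<open>x = 0\<close>. Since these data determine
  the solution by unique continuation in \<open>x\<close>, \<open>v = u + K u\<close> on the whole rectangle, so the data at
  \<open>t = \<tau>\<close> say that \<open>K x (u \<tau>) = 0\<close> for all \<open>x\<close>. Two derivatives in \<open>x\<close> give
  \<open>(Q x - P x) (u \<tau> x) = - \<sigma> K x (\<partial>\<^sub>t u \<tau>)\<close>, hence \<open>|Q x - P x| \<le> c |K x|\<close> because the columns \<open>u \<tau> x\<close> form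
  an invertible matrix. As \<open>|K x|\<close> is bounded by a multiple of the integral of \<open>|Q - P| + |K|\<close> over
  \<open>{0..x}\<close>, Gronwall's inequality yields \<open>K = 0\<close> and \<open>P = Q\<close>.
\<close>

section \<open>Calculus on an interval\<close>

text \<open>Classically a transmutation operator is an integral operator whose kernel solves a
  Goursat problem. Here \<open>K x\<close> is instead a functional on continuous functions, fixed by
  an integrated form of that problem, so x-derivatives fall on the function it is applied to and the
  regularity of a kernel is never discussed. The even extension turns the Neumann condition into a
  symmetry: waves cross \<open>x = 0\<close> freely and no boundary term arises there. Nothing is
  prescribed at \<open>x = l\<close>, and \<open>\<sigma>\<close> may be any complex direction
  (heat, backward heat, Schroedinger), so neither energy estimates nor smoothing in time are at
  hand. What remains is to solve sideways, with x as evolution variable and Cauchy data at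
  \<open>x = 0\<close>. The formal solution is a power series in x with ever higher time
  derivatives, while the solutions have a single one. This is why the derivatives are moved to
  polynomial weights in t: n of them cost about \<open>n ^ n\<close>, and the 2n integrations in x
  that pay for them gain \<open>fact (2 * n)\<close>. Time is only a parameter for \<open>K\<close>,
  which therefore commutes with the time derivative, and it commutes with \<open>\<sigma>\<close>
  because P and Q are complex linear.\<close>

lemma vector_derivative_lipschitz:
  fixes f :: "real \<Rightarrow> 'a::real_normed_vector"
  assumes "convex S" "\<And>x. x \<in> S \<Longrightarrow> (f has_vector_derivative f' x) (at x within S)"
    and "\<And>x. x \<in> S \<Longrightarrow> norm (f' x) \<le> B" and "x \<in> S" "y \<in> S"
  shows "norm (f x - f y) \<le> B * \<bar>x - y\<bar>"
proof -
  have "norm (f x - f y) \<le> B * norm (x - y)"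
  proof (rule differentiable_bound[OF assms(1), where f' = "\<lambda>x h. h *\<^sub>R f' x"])
    fix z assume z: "z \<in> S"
    then show "(f has_derivative (\<lambda>h. h *\<^sub>R f' z)) (at z within S)"
      using assms(2) by (simp add: has_vector_derivative_def)
    have "norm (h *\<^sub>R f' z) \<le> B * norm h" for h
      using mult_left_mono[OF assms(3)[OF z] norm_ge_zero[of h]] by (simp add: mult.commute)
    then show "onorm (\<lambda>h. h *\<^sub>R f' z) \<le> B"
      using order_trans[OF norm_ge_zero assms(3)[OF z]] by (intro onorm_bound) auto
  qed (use assms in auto)
  then show ?thesis by simp
qed

text \<open>The right-hand side of \<open>le\<close> has derivative \<open>c * y x\<close>, at most
  \<open>c\<close> times itself, so its product with \<open>exp (- c * x)\<close> decreases. It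
  serves twice: with \<open>a = 0\<close> to make the functionals vanish, and in
  \<open>W_bound\<close> to absorb the zero-order term.\<close>

lemma gronwall:
  fixes y :: "real \<Rightarrow> real"
  assumes cont: "continuous_on {0..l} y" and "c \<ge> 0"
    and le: "\<And>x. x \<in> {0..l} \<Longrightarrow> y x \<le> a + c * integral {0..x} y" and x: "x \<in> {0..l}"
  shows "y x \<le> a * exp (c * x)"
proof -
  define g where "g x = exp (- c * x) * (a + c * integral {0..x} y)" for x
  have "g x \<le> g 0"
  proof (rule DERIV_nonpos_imp_decreasing_open[of 0 x])
    show "0 \<le> x" using x by simp
    show "\<exists>d. (g has_real_derivative d) (at z) \<and> d \<le> 0" if "0 < z" "z < x" for z
    proof -
      have "((\<lambda>u. integral {0..u} y) has_vector_derivative y z) (at z within {0..l})"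
        using integral_has_vector_derivative[OF cont, of z] that x by auto
      then have "((\<lambda>u. integral {0..u} y) has_real_derivative y z) (at z)"
        using that x by (auto simp: has_real_derivative_iff_has_vector_derivative
            at_within_interior[of z "{0..l}"])
      then have "(g has_real_derivative
          exp (- c * z) * (c * y z) - c * exp (- c * z) * (a + c * integral {0..z} y)) (at z)"
        unfolding g_def by (auto intro!: derivative_eq_intros simp: algebra_simps)
      moreover have "c * exp (- c * z) * (y z - (a + c * integral {0..z} y)) \<le> 0"
        using le[of z] that x \<open>c \<ge> 0\<close> by (intro mult_nonneg_nonpos) auto
      ultimately show ?thesis by (intro exI conjI) (auto simp: algebra_simps)
    qed
    have "continuous_on {0..l} (\<lambda>u. integral {0..u} y)"
      using integrable_continuous_real[OF cont] by (rule indefinite_integral_continuous_1)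
    then have "continuous_on {0..x} (\<lambda>u. integral {0..u} y)"
      by (rule continuous_on_subset) (use x in auto)
    then show "continuous_on {0..x} g"
      unfolding g_def by (intro continuous_intros)
  qed
  then have "a + c * integral {0..x} y \<le> a * exp (c * x)"
    by (simp add: g_def exp_minus field_simps)
  then show ?thesis using le[OF x] by linarith
qed

text \<open>The signed integral from 0, which avoids the junk value 0 of \<open>integral {0..z}\<close> for \<open>z < 0\<close>.\<close>

definition prim :: "(real \<Rightarrow> 'a::euclidean_space) \<Rightarrow> real \<Rightarrow> 'a" where
  "prim f z = integral {0..z} f - integral {z..0} f"

lemma prim_0 [simp]: "prim f 0 = 0"
  by (simp add: prim_def)

lemma prim_has_vector_derivative:
  assumes cont: "continuous_on UNIV f"
  shows "(prim f has_vector_derivative f z) (at z within S)"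
proof -
  define R where "R = \<bar>z\<bar> + 1"
  then have zR: "z \<in> {-R..R}" by auto
  have int: "f integrable_on {a..b}" for a b
    by (rule integrable_continuous_real, rule continuous_on_subset[OF cont]) simp
  \<comment> \<open>Written as an integral from the fixed left end \<open>-R\<close>, up to a
    constant, the primitive can be differentiated across 0 without splitting by sign.\<close>
  have eq: "prim f y = integral {-R..y} f - integral {-R..0} f" if "y \<in> {-R..R}" for y
  proof (cases "y \<ge> 0")
    case True
    then have "integral {-R..0} f + integral {0..y} f = integral {-R..y} f"
      by (intro Henstock_Kurzweil_Integration.integral_combine int) (auto simp: R_def)
    moreover have "integral {y..0} f = 0" using True by (cases "y = 0") auto
    ultimately show ?thesis by (simp add: prim_def algebra_simps)
  next
    case False
    then have "integral {-R..y} f + integral {y..0} f = integral {-R..0} f"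
      using that by (intro Henstock_Kurzweil_Integration.integral_combine int) auto
    moreover have "integral {0..y} f = 0" using False by auto
    ultimately show ?thesis by (simp add: prim_def algebra_simps)
  qed
  have "((\<lambda>u. integral {-R..u} f - integral {-R..0} f) has_vector_derivative f z - 0) (at z within {-R..R})"
    by (intro derivative_intros integral_has_vector_derivative continuous_on_subset[OF cont])
      (auto simp: R_def)
  then have "(prim f has_vector_derivative f z) (at z within {-R..R})"
    unfolding diff_0_right by (rule has_vector_derivative_transform[OF zR eq, rotated])
  then have "(prim f has_vector_derivative f z) (at z)"
    by (subst (asm) at_within_interior) (auto simp: R_def)
  then show ?thesis by (rule has_vector_derivative_at_within)
qed

lemma prim_has_vector_derivative_comp [derivative_intros]:
  assumes "continuous_on UNIV f" "(g has_real_derivative g') (at x within S)"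
  shows "((\<lambda>x. prim f (g x)) has_vector_derivative g' *\<^sub>R f (g x)) (at x within S)"
  using vector_diff_chain_within[OF assms(2)[unfolded has_real_derivative_iff_has_vector_derivative]
      prim_has_vector_derivative[OF assms(1)]]
  by (simp add: o_def)

lemma continuous_on_prim:
  assumes "continuous_on UNIV f" shows "continuous_on S (prim f)"
  using prim_has_vector_derivative[OF assms] has_vector_derivative_continuous
  by (force simp: continuous_on_eq_continuous_within)

lemma prim_lipschitz:
  assumes "continuous_on UNIV f" "\<And>x. norm (f x) \<le> B"
  shows "norm (prim f x - prim f y) \<le> B * \<bar>x - y\<bar>"
  by (rule vector_derivative_lipschitz[of UNIV])
    (use assms prim_has_vector_derivative in auto)

lemma prim_eqI:
  assumes "x \<ge> 0" "\<And>z. z \<in> {0..x} \<Longrightarrow> (F has_vector_derivative f z) (at z within {0..x})"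
  shows "prim f x = F x - F 0"
proof -
  have "(f has_integral (F x - F 0)) {0..x}"
    by (rule fundamental_theorem_of_calculus) (use assms in auto)
  moreover have "integral {x..0} f = 0" using assms(1) by (cases "x = 0") auto
  ultimately show ?thesis by (simp add: prim_def integral_unique)
qed

lemma prim_cong:
  assumes "\<And>y. \<bar>y\<bar> \<le> \<bar>z\<bar> \<Longrightarrow> f y = g y"
  shows "prim f z = prim g z"
  unfolding prim_def by (intro arg_cong2[where f = minus] integral_cong assms) auto

lemma prim_minus: "prim f (- z) = - prim (\<lambda>y. f (- y)) z"
  using Henstock_Kurzweil_Integration.integral_reflect_real[of z 0 "\<lambda>y. f (- y)"]
    Henstock_Kurzweil_Integration.integral_reflect_real[of 0 z "\<lambda>y. f (- y)"]
  by (simp add: prim_def)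

lemma prim_bounded_linear:
  assumes "bounded_linear h" "continuous_on UNIV f"
  shows "prim (\<lambda>y. h (f y)) z = h (prim f z)"
proof -
  have int: "f integrable_on {a..b}" for a b
    by (rule integrable_continuous_real, rule continuous_on_subset[OF assms(2)]) simp
  interpret bounded_linear h by fact
  show ?thesis
    using integral_linear[OF int assms(1)] by (simp add: prim_def o_def diff)
qed

lemma prim_add:
  assumes "continuous_on UNIV f" "continuous_on UNIV g"
  shows "prim (\<lambda>y. f y + g y) z = prim f z + prim g z"
proof -
  have int: "f integrable_on {a..b}" "g integrable_on {a..b}" for a b
    by (rule integrable_continuous_real, rule continuous_on_subset, use assms in auto)+
  show ?thesis unfolding prim_def by (simp add: integral_add int)
qed

section \<open>Continuous functions on \<open>{-l..l}\<close> as elements of a Banach space\<close>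

text \<open>Freezing \<open>f\<close> at its end values makes it bounded and continuous on the whole
  line without changing its sup norm. The complete type of bounded continuous functions can thus
  play the part of the continuous functions on \<open>{-l..l}\<close>.\<close>

definition clamped :: "real \<Rightarrow> (real \<Rightarrow> 'a::metric_space) \<Rightarrow> real \<Rightarrow>\<^sub>C 'a" where
  "clamped l f = Bcontfun (\<lambda>y. f (max (- l) (min l y)))"

lemma clamped_apply:
  assumes "l \<ge> 0" "continuous_on {-l..l} f"
  shows "apply_bcontfun (clamped l f) y = f (max (- l) (min l y))"
proof -
  let ?c = "\<lambda>y. max (- l) (min l y)"
  have "continuous_on UNIV (\<lambda>y. f (?c y))"
    by (rule continuous_on_compose2[OF assms(2)]) (use assms(1) in \<open>auto intro!: continuous_intros\<close>)
  moreover have "bounded (range (\<lambda>y. f (?c y)))"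
    by (rule bounded_subset[OF compact_imp_bounded[OF compact_continuous_image[OF assms(2)]]])
      (use assms(1) in auto)
  ultimately show ?thesis
    unfolding clamped_def by (subst Bcontfun_inverse) (auto simp: bcontfun_def)
qed

lemma clamped_cong:
  assumes "l \<ge> 0" "\<And>y. \<bar>y\<bar> \<le> l \<Longrightarrow> f y = g y"
  shows "clamped l f = clamped l g"
  unfolding clamped_def by (intro arg_cong[where f = Bcontfun] ext assms(2)) (use assms(1) in auto)

lemma norm_clamped_le:
  fixes f :: "real \<Rightarrow> 'a::real_normed_vector"
  assumes "l \<ge> 0" "continuous_on {-l..l} f" "\<And>y. \<bar>y\<bar> \<le> l \<Longrightarrow> norm (f y) \<le> B"
  shows "norm (clamped l f) \<le> B"
  by (rule norm_bound, subst clamped_apply) (use assms in auto)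

lemma dist_clamped_le:
  assumes "l \<ge> 0" "continuous_on {-l..l} f" "continuous_on {-l..l} g"
    "\<And>y. \<bar>y\<bar> \<le> l \<Longrightarrow> dist (f y) (g y) \<le> B"
  shows "dist (clamped l f) (clamped l g) \<le> B"
  by (rule dist_bound) (use assms in \<open>auto simp: clamped_apply\<close>)

lemma clamped_add:
  fixes f g :: "real \<Rightarrow> 'a::real_normed_vector"
  assumes "l \<ge> 0" "continuous_on {-l..l} f" "continuous_on {-l..l} g"
  shows "clamped l (\<lambda>y. f y + g y) = clamped l f + clamped l g"
  by (rule bcontfun_eqI) (use assms in \<open>auto simp: clamped_apply continuous_on_add\<close>)

lemma clamped_diff:
  fixes f g :: "real \<Rightarrow> 'a::real_normed_vector"
  assumes "l \<ge> 0" "continuous_on {-l..l} f" "continuous_on {-l..l} g"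
  shows "clamped l (\<lambda>y. f y - g y) = clamped l f - clamped l g"
  by (rule bcontfun_eqI) (use assms in \<open>auto simp: clamped_apply continuous_on_diff\<close>)

lemma clamped_scaleR:
  fixes f :: "real \<Rightarrow> 'a::real_normed_vector"
  assumes "l \<ge> 0" "continuous_on {-l..l} f"
  shows "clamped l (\<lambda>y. r *\<^sub>R f y) = r *\<^sub>R clamped l f"
  by (rule bcontfun_eqI) (use assms in \<open>auto simp: clamped_apply continuous_on_scaleR\<close>)

lemma continuous_on_section_snd:
  assumes "continuous_on (S \<times> T) (\<lambda>(s, y). g s y)" "s \<in> S"
  shows "continuous_on T (g s)"
  by (rule continuous_on_compose2[OF assms(1), of T "\<lambda>y. (s, y)", simplified])
    (use assms(2) in \<open>auto intro!: continuous_intros\<close>)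

lemma continuous_on_section_fst:
  assumes "continuous_on (S \<times> T) (\<lambda>(s, y). g s y)" "y \<in> T"
  shows "continuous_on S (\<lambda>s. g s y)"
  by (rule continuous_on_compose2[OF assms(1), of S "\<lambda>s. (s, y)", simplified])
    (use assms(2) in \<open>auto intro!: continuous_intros\<close>)

text \<open>Compactness of \<open>{-l..l}\<close> makes joint continuity uniform in
  \<open>y\<close>, which is continuity in the sup norm.\<close>

lemma continuous_on_clamped:
  fixes g :: "'b::topological_space \<Rightarrow> real \<Rightarrow> 'a::metric_space"
  assumes "l \<ge> 0" and cont: "continuous_on (S \<times> {-l..l}) (\<lambda>(s, y). g s y)"
  shows "continuous_on S (\<lambda>s. clamped l (g s))"
  unfolding continuous_on_def
proof (intro ballI tendstoI)
  fix s and e :: real assume s: "s \<in> S" and e: "0 < e"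
  then have "0 < e / 2" by simp
  from continuous_on_prod_compactE[OF cont compact_Icc s this]
  obtain X0 where X0: "s \<in> X0" "open X0"
    and B: "\<forall>r\<in>X0 \<inter> S. \<forall>y\<in>{-l..l}. dist (g r y) (g s y) \<le> e / 2"
    unfolding split_beta fst_conv snd_conv by metis
  have "\<forall>\<^sub>F r in at s within S. r \<in> X0 \<inter> S"
    using X0 eventually_at_topological by auto
  then show "\<forall>\<^sub>F r in at s within S. dist (clamped l (g r)) (clamped l (g s)) < e"
  proof eventually_elim
    case (elim r)
    have "dist (clamped l (g r)) (clamped l (g s)) \<le> e / 2"
      by (rule dist_clamped_le) (use assms s elim B continuous_on_section_snd[OF cont] in \<open>auto simp: abs_le_iff\<close>)
    then show ?case using e by linarith
  qed
qed

text \<open>By the mean value inequality the error of the linearization at \<open>s\<close> is at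
  most the oscillation of \<open>g'\<close> between \<open>s\<close> and \<open>r\<close>, which is
  small uniformly in \<open>y\<close> by compactness. Derivatives in t or x can therefore be taken
  inside any bounded functional.\<close>

lemma clamped_has_vector_derivative:
  fixes g :: "real \<Rightarrow> real \<Rightarrow> 'a::real_normed_vector"
  assumes "l \<ge> 0" and cont: "continuous_on (S \<times> {-l..l}) (\<lambda>(s, y). g s y)"
    and cont': "continuous_on (S \<times> {-l..l}) (\<lambda>(s, y). g' s y)"
    and deriv: "\<And>s y. s \<in> S \<Longrightarrow> y \<in> {-l..l} \<Longrightarrow>
      ((\<lambda>s. g s y) has_vector_derivative g' s y) (at s within S)"
    and "convex S" "s \<in> S"
  shows "((\<lambda>s. clamped l (g s)) has_vector_derivative clamped l (g' s)) (at s within S)"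
  unfolding has_vector_derivative_def has_derivative_within_alt
proof (intro conjI allI impI)
  show "bounded_linear (\<lambda>h. h *\<^sub>R clamped l (g' s))" by (rule bounded_linear_scaleR_left)
  fix e :: real assume e: "0 < e"
  from continuous_on_prod_compactE[OF cont' compact_Icc \<open>s \<in> S\<close> e]
  obtain X0 where X0: "s \<in> X0" "open X0"
    and B: "\<forall>r\<in>X0 \<inter> S. \<forall>y\<in>{-l..l}. dist (g' r y) (g' s y) \<le> e"
    unfolding split_beta fst_conv snd_conv by metis
  obtain d where d: "d > 0" "ball s d \<subseteq> X0" using X0 open_contains_ball by blast
  show "\<exists>d>0. \<forall>r\<in>S. norm (r - s) < d \<longrightarrow>
      norm (clamped l (g r) - clamped l (g s) - (r - s) *\<^sub>R clamped l (g' s)) \<le> e * norm (r - s)"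
  proof (intro exI[of _ d] conjI ballI impI)
    fix r assume r: "r \<in> S" "norm (r - s) < d"
    let ?S = "ball s d \<inter> S"
    have cont_g: "continuous_on {-l..l} (g r)" "continuous_on {-l..l} (g s)" "continuous_on {-l..l} (g' s)"
      using continuous_on_section_snd[OF cont] continuous_on_section_snd[OF cont'] r assms by auto
    have "norm (g r y - g s y - (r - s) *\<^sub>R g' s y) \<le> norm (r - s) * e" if "\<bar>y\<bar> \<le> l" for y
    proof (rule vector_differentiable_bound_linearization[where S = ?S and ?x0.0 = s and f' = "\<lambda>r. g' r y"])
      show "closed_segment s r \<subseteq> ?S"
        using r \<open>s \<in> S\<close> \<open>convex S\<close> d
        by (intro closed_segment_subset convex_Int) (auto simp: dist_norm norm_minus_commute)
      show "((\<lambda>r. g r y) has_vector_derivative g' z y) (at z within ?S)" if "z \<in> ?S" for z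
        by (rule has_vector_derivative_within_subset[OF deriv]) (use that \<open>\<bar>y\<bar> \<le> l\<close> in auto)
      show "norm (g' z y - g' s y) \<le> e" if "z \<in> ?S" for z
      proof -
        have z: "z \<in> X0 \<inter> S" and y: "y \<in> {-l..l}" using that d \<open>\<bar>y\<bar> \<le> l\<close> by auto
        show ?thesis using bspec[OF bspec[OF B z] y] by (simp add: dist_norm)
      qed
    qed (use \<open>s \<in> S\<close> d in auto)
    moreover have "clamped l (g r) - clamped l (g s) - (r - s) *\<^sub>R clamped l (g' s)
        = clamped l (\<lambda>y. g r y - g s y - (r - s) *\<^sub>R g' s y)"
      using cont_g \<open>l \<ge> 0\<close> by (simp add: clamped_diff clamped_scaleR continuous_on_diff continuous_on_scaleR)
    ultimately show "norm (clamped l (g r) - clamped l (g s) - (r - s) *\<^sub>R clamped l (g' s)) \<le> e * norm (r - s)"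
      using cont_g \<open>l \<ge> 0\<close>
      by (auto intro!: norm_clamped_le continuous_on_diff continuous_on_scaleR simp: mult.commute)
  qed (use d in auto)
qed

section \<open>Volterra integrals whose integrand depends on a parameter\<close>

text \<open>The substitution \<open>s = a * r\<close> moves the variable end point into the
  integrand, so continuity of integrals over the fixed interval from 0 to 1 applies;
  \<open>a = 0\<close> needs no special treatment.\<close>

lemma continuous_on_volterra2:
  fixes G :: "real \<Rightarrow> real \<Rightarrow> 'a::banach"
  assumes cont: "continuous_on ({0..l} \<times> {0..l}) (\<lambda>(b, s). G b s)"
  shows "continuous_on ({0..l} \<times> {0..l}) (\<lambda>(a, b). integral {0..a} (G b))"
proof -
  have eq: "integral {0..a} (G b) = a *\<^sub>R integral {0..1} (\<lambda>r. G b (a * r))"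
    if "a \<in> {0..l}" "b \<in> {0..l}" for a b
  proof -
    have c: "continuous_on {0..a} (G b)"
      by (rule continuous_on_subset[OF continuous_on_section_snd[OF cont that(2)]]) (use that in auto)
    have "((\<lambda>r. a *\<^sub>R G b (a * r)) has_integral (integral {0..a} (G b) - integral {0..0} (G b))) {0..1}"
    proof (rule fundamental_theorem_of_calculus[of 0 1 "\<lambda>r. integral {0..a * r} (G b)", unfolded mult_1_right mult_zero_right])
      fix r :: real assume r: "r \<in> {0..1}"
      have "((\<lambda>u. integral {0..u} (G b)) has_vector_derivative G b (a * r)) (at (a * r) within {0..a})"
        by (rule integral_has_vector_derivative[OF c]) (use r that in \<open>auto simp: mult_left_le\<close>)
      then have *: "((\<lambda>u. integral {0..u} (G b)) has_vector_derivative G b (a * r))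
          (at (a * r) within (\<lambda>r. a * r) ` {0..1})"
        by (rule has_vector_derivative_within_subset) (use that in \<open>auto simp: mult_left_le\<close>)
      have "((\<lambda>r. a * r) has_vector_derivative a) (at r within {0..1})"
        by (auto intro!: derivative_eq_intros simp: has_real_derivative_iff_has_vector_derivative[symmetric])
      from vector_diff_chain_within[OF this *]
      show "((\<lambda>r. integral {0..a * r} (G b)) has_vector_derivative a *\<^sub>R G b (a * r)) (at r within {0..1})"
        by (simp add: o_def)
    qed simp
    then show ?thesis by (auto dest!: integral_unique)
  qed
  have "continuous_on (({0..l} \<times> {0..l}) \<times> cbox 0 1) (\<lambda>(p, r). (\<lambda>(b, s). G b s) (snd p, fst p * r))"
    unfolding split_beta
    by (rule continuous_on_compose2[OF cont[unfolded split_beta]])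
      (auto intro!: continuous_intros simp: mult_left_le order_trans[OF mult_left_le])
  then have "continuous_on ({0..l} \<times> {0..l})
      (\<lambda>p. fst p *\<^sub>R integral (cbox 0 1) (\<lambda>r. G (snd p) (fst p * r)))"
    by (intro continuous_intros integral_continuous_on_param) (simp add: split_beta)
  then show ?thesis
    by (rule continuous_on_eq) (auto simp: eq)
qed

lemma continuous_on_volterra:
  fixes G :: "real \<Rightarrow> real \<Rightarrow> 'a::banach"
  assumes cont: "continuous_on ({0..l} \<times> {0..l}) (\<lambda>(b, s). G b s)"
  shows "continuous_on {0..l} (\<lambda>x. integral {0..x} (G x))"
  by (rule continuous_on_compose2[OF continuous_on_volterra2[OF cont], of _ "\<lambda>x. (x, x)", simplified])
    (auto intro!: continuous_intros)

text \<open>Upper limit and parameter are first separated into \<open>a\<close> and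
  \<open>b\<close>. The integral is differentiable in each, with the \<open>b\<close>-derivative
  jointly continuous, hence totally differentiable, and the chain rule along the diagonal gives the
  two terms.\<close>

lemma volterra_has_vector_derivative:
  fixes G :: "real \<Rightarrow> real \<Rightarrow> 'a::banach"
  assumes cont: "continuous_on ({0..l} \<times> {0..l}) (\<lambda>(b, s). G b s)"
    and cont': "continuous_on ({0..l} \<times> {0..l}) (\<lambda>(b, s). G' b s)"
    and deriv: "\<And>b s. b \<in> {0..l} \<Longrightarrow> s \<in> {0..l} \<Longrightarrow>
      ((\<lambda>b. G b s) has_vector_derivative G' b s) (at b within {0..l})"
    and x: "x \<in> {0..l}"
  shows "((\<lambda>x. integral {0..x} (G x)) has_vector_derivative G x x + integral {0..x} (G' x))
    (at x within {0..l})"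
proof -
  have sub: "{0..a} \<subseteq> {0..l}" if "a \<in> {0..l}" for a using that by auto
  have 1: "((\<lambda>a. integral {0..a} (G x)) has_derivative (\<lambda>h. h *\<^sub>R G x x)) (at x within {0..l})"
    using integral_has_vector_derivative[OF continuous_on_section_snd[OF cont x] x]
    by (simp add: has_vector_derivative_def)
  have 2: "((\<lambda>b. integral {0..a} (G b)) has_derivative
      blinfun_apply (blinfun_scaleR_left (integral {0..a} (G' b)))) (at b within {0..l})"
    if ab: "a \<in> {0..l}" "b \<in> {0..l}" for a b
  proof -
    have "((\<lambda>b. integral (cbox 0 a) (G b)) has_vector_derivative integral (cbox 0 a) (G' b)) (at b within {0..l})"
    proof (rule leibniz_rule_vector_derivative)
      show "G z integrable_on cbox 0 a" if "z \<in> {0..l}" for z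
        using continuous_on_subset[OF continuous_on_section_snd[OF cont that] sub[OF ab(1)]]
        by (simp add: integrable_continuous_real)
      show "continuous_on ({0..l} \<times> cbox 0 a) (\<lambda>(b, s). G' b s)"
        by (rule continuous_on_subset[OF cont']) (use ab in auto)
    qed (use ab in \<open>auto intro!: deriv\<close>)
    then show ?thesis by (simp add: has_vector_derivative_def)
  qed
  have 3: "continuous (at (x, x) within {0..l} \<times> {0..l})
      (\<lambda>(a, b). blinfun_scaleR_left (integral {0..a} (G' b)))"
  proof -
    have "continuous_on ({0..l} \<times> {0..l}) (\<lambda>(a, b). blinfun_scaleR_left (integral {0..a} (G' b)))"
      using continuous_on_volterra2[OF cont'] unfolding split_beta by (intro continuous_intros)
    then show ?thesis using x by (auto simp: continuous_on_eq_continuous_within)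
  qed
  have "((\<lambda>(a, b). integral {0..a} (G b)) has_derivative
      (\<lambda>(h, k). h *\<^sub>R G x x + blinfun_apply (blinfun_scaleR_left (integral {0..x} (G' x))) k))
      (at (x, x) within {0..l} \<times> {0..l})"
    by (rule has_derivative_partialsI[OF 1 2 3 x]) auto
  then have "((\<lambda>(a, b). integral {0..a} (G b)) has_derivative
      (\<lambda>(h, k). h *\<^sub>R G x x + k *\<^sub>R integral {0..x} (G' x))) (at (x, x) within (\<lambda>x. (x, x)) ` {0..l})"
    by (auto intro: has_derivative_subset)
  moreover have "((\<lambda>x. (x, x)) has_derivative (\<lambda>h. (h, h))) (at x within {0..l})"
    by (auto intro!: derivative_eq_intros)
  ultimately show ?thesis
    using diff_chain_within by (fastforce simp: has_vector_derivative_def o_def scaleR_add_right)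
qed

section \<open>The transmutation operator\<close>

lemma volterra_equation_ex:
  fixes L :: "real \<Rightarrow> real \<Rightarrow> 'b::banach \<Rightarrow> 'b"
  assumes "l \<ge> 0"
    and cont: "continuous_on (({0..l} \<times> {0..l}) \<times> UNIV) (\<lambda>((x, s), z). L x s z)"
    and lip: "\<And>x s z z'. x \<in> {0..l} \<Longrightarrow> s \<in> {0..l} \<Longrightarrow> norm (L x s z - L x s z') \<le> M * norm (z - z')"
  shows "\<exists>Z. continuous_on {0..l} Z \<and> (\<forall>x\<in>{0..l}. Z x = integral {0..x} (\<lambda>s. L x s (Z s)))"
proof -
  text \<open>The weight \<open>exp (- c x)\<close> turns the Picard map into a contraction on all of \<open>{0..l}\<close>.\<close>
  define M1 where "M1 = \<bar>M\<bar> + 1"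
  \<comment> \<open>Integrating \<open>M1 * exp (c * s)\<close> yields the factor
    \<open>M1 / c\<close>, which is the contraction constant 1/2. \<open>M1\<close> replaces
    \<open>M\<close> to be strictly positive.\<close>
  define c where "c = 2 * M1"
  have M1: "M1 > 0" and c: "c > 0" by (auto simp: M1_def c_def)
  define G where "G \<phi> x s = L x s (exp (c * s) *\<^sub>R apply_bcontfun \<phi> s)" for \<phi> x s
  define F where "F \<phi> x = exp (- c * x) *\<^sub>R integral {0..x} (G \<phi> x)" for \<phi> x
  have cont_G: "continuous_on ({0..l} \<times> {0..l}) (\<lambda>(x, s). G \<phi> x s)" for \<phi>
  proof -
    have "continuous_on ({0..l} \<times> {0..l})
       (\<lambda>p. (\<lambda>((x, s), z). L x s z) (p, exp (c * snd p) *\<^sub>R apply_bcontfun \<phi> (snd p)))"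
      by (rule continuous_on_compose2[OF cont])
        (auto intro!: continuous_intros continuous_on_compose2[OF continuous_on_apply_bcontfun[of UNIV]])
    then show ?thesis by (simp add: G_def split_beta)
  qed
  \<comment> \<open>The unknown is the solution times \<open>exp (- c * x)\<close>. It lives on
    \<open>{0..l}\<close>, and taking the absolute value of the argument extends it to
    \<open>{-l..l}\<close>, where \<open>clamped\<close> supplies a complete space.\<close>
  have cont_F: "continuous_on {-l..l} (\<lambda>y. F \<phi> \<bar>y\<bar>)" for \<phi>
  proof -
    have "continuous_on {0..l} (F \<phi>)"
      unfolding F_def by (intro continuous_intros continuous_on_volterra cont_G)
    then show ?thesis
      by (rule continuous_on_compose2) (auto intro!: continuous_intros)
  qed
  have "dist (clamped l (\<lambda>y. F \<phi> \<bar>y\<bar>)) (clamped l (\<lambda>y. F \<psi> \<bar>y\<bar>)) \<le> 1 / 2 * dist \<phi> \<psi>" for \<phi> \<psi>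
  proof (rule dist_clamped_le[OF \<open>l \<ge> 0\<close> cont_F cont_F])
    fix y :: real assume "\<bar>y\<bar> \<le> l"
    define x where "x = \<bar>y\<bar>"
    have x: "x \<in> {0..l}" using \<open>\<bar>y\<bar> \<le> l\<close> by (simp add: x_def)
    let ?D = "dist \<phi> \<psi>"
    have int: "G \<theta> x integrable_on {0..x}" for \<theta>
      by (rule integrable_continuous_real, rule continuous_on_subset[OF continuous_on_section_snd[OF cont_G x]])
        (use x in auto)
    have hi: "((\<lambda>s. M1 * ?D * exp (c * s)) has_integral
        M1 * ?D * (exp (c * x) / c) - M1 * ?D * (exp (c * 0) / c)) {0..x}"
      by (rule fundamental_theorem_of_calculus)
        (use x c in \<open>auto intro!: derivative_eq_intros simp: has_real_derivative_iff_has_vector_derivative[symmetric]\<close>)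
    have "norm (integral {0..x} (G \<phi> x) - integral {0..x} (G \<psi> x))
        = norm (integral {0..x} (\<lambda>s. G \<phi> x s - G \<psi> x s))"
      by (simp add: integral_diff int)
    also have "\<dots> \<le> integral {0..x} (\<lambda>s. M1 * ?D * exp (c * s))"
    proof (rule integral_norm_bound_integral)
      fix s assume s: "s \<in> {0..x}"
      have "norm (G \<phi> x s - G \<psi> x s)
          \<le> M * norm (exp (c * s) *\<^sub>R apply_bcontfun \<phi> s - exp (c * s) *\<^sub>R apply_bcontfun \<psi> s)"
        unfolding G_def by (rule lip) (use s x in auto)
      also have "\<dots> \<le> M1 * norm (exp (c * s) *\<^sub>R apply_bcontfun \<phi> s - exp (c * s) *\<^sub>R apply_bcontfun \<psi> s)"
        by (rule mult_right_mono) (auto simp: M1_def)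
      also have "\<dots> = M1 * (exp (c * s) * dist (apply_bcontfun \<phi> s) (apply_bcontfun \<psi> s))"
        by (simp add: scaleR_diff_right[symmetric] dist_norm)
      also have "\<dots> \<le> M1 * (exp (c * s) * ?D)"
        using M1 by (intro mult_left_mono dist_bounded) auto
      finally show "norm (G \<phi> x s - G \<psi> x s) \<le> M1 * ?D * exp (c * s)"
        by (simp add: mult_ac)
    qed (use int hi in \<open>auto intro!: integrable_diff\<close>)
    also have "\<dots> = ?D / 2 * (exp (c * x) - 1)"
      using integral_unique[OF hi] M1 by (simp add: c_def field_simps)
    also have "\<dots> \<le> ?D / 2 * exp (c * x)"
      by (intro mult_left_mono) auto
    finally have "norm (integral {0..x} (G \<phi> x) - integral {0..x} (G \<psi> x)) \<le> ?D / 2 * exp (c * x)" .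
    moreover have "dist (F \<phi> x) (F \<psi> x)
        = exp (- c * x) * norm (integral {0..x} (G \<phi> x) - integral {0..x} (G \<psi> x))"
      by (simp add: F_def dist_norm scaleR_diff_right[symmetric])
    ultimately have "dist (F \<phi> x) (F \<psi> x) \<le> exp (- c * x) * (?D / 2 * exp (c * x))"
      by simp
    then show "dist (F \<phi> \<bar>y\<bar>) (F \<psi> \<bar>y\<bar>) \<le> 1 / 2 * ?D"
      by (simp add: x_def exp_minus field_simps)
  qed
  then have "\<exists>!\<phi>. clamped l (\<lambda>y. F \<phi> \<bar>y\<bar>) = \<phi>"
    by (intro banach_fix_type[of "1 / 2"]) auto
  then obtain \<phi> where \<phi>: "clamped l (\<lambda>y. F \<phi> \<bar>y\<bar>) = \<phi>" by auto
  have fix_eq: "apply_bcontfun \<phi> x = F \<phi> x" if "x \<in> {0..l}" for x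
    using clamped_apply[OF \<open>l \<ge> 0\<close> cont_F, of \<phi> x] that by (simp add: \<phi>)
  show ?thesis
  proof (intro exI conjI ballI)
    show "continuous_on {0..l} (\<lambda>x. exp (c * x) *\<^sub>R apply_bcontfun \<phi> x)"
      by (intro continuous_intros continuous_on_apply_bcontfun)
    show "exp (c * x) *\<^sub>R apply_bcontfun \<phi> x = integral {0..x} (\<lambda>s. L x s (exp (c * s) *\<^sub>R apply_bcontfun \<phi> s))"
      if "x \<in> {0..l}" for x
      using fix_eq[OF that] by (simp add: F_def G_def[abs_def] exp_minus)
  qed
qed

text \<open>
  \<open>wave f r\<close> and \<open>mean f r\<close> solve the wave equation in \<open>(r, y)\<close> with initial velocity, respectively
  position, \<open>f\<close> (d'Alembert).
\<close>

definition wave :: "(real \<Rightarrow> 'a::euclidean_space) \<Rightarrow> real \<Rightarrow> real \<Rightarrow> 'a" where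
  "wave f r y = (1 / 2) *\<^sub>R (prim f (y + r) - prim f (y - r))"

definition mean :: "(real \<Rightarrow> 'a::euclidean_space) \<Rightarrow> real \<Rightarrow> real \<Rightarrow> 'a" where
  "mean f r y = (1 / 2) *\<^sub>R (f (y + r) + f (y - r))"

lemma wave_0 [simp]: "wave f 0 y = 0"
  by (simp add: wave_def)

lemma mean_0 [simp]: "mean f 0 y = f y"
  by (simp add: mean_def scaleR_2[symmetric])

lemma continuous_on_wave2:
  assumes "continuous_on UNIV f"
  shows "continuous_on S (\<lambda>(r, y). wave f r y)"
  unfolding wave_def split_beta
  by (intro continuous_intros continuous_on_compose2[OF continuous_on_prim[OF assms, of UNIV]]) auto

lemma continuous_on_mean2:
  assumes "continuous_on UNIV f"
  shows "continuous_on S (\<lambda>(r, y). mean f r y)"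
  unfolding mean_def split_beta
  by (intro continuous_intros continuous_on_compose2[OF assms]) auto

lemma continuous_on_wave:
  assumes "continuous_on UNIV f" shows "continuous_on S (wave f r)"
  using continuous_on_section_snd[OF continuous_on_wave2[OF assms], of r UNIV S] by auto

lemma wave_has_vector_derivative:
  assumes "continuous_on UNIV f"
  shows "((\<lambda>r. wave f r y) has_vector_derivative mean f r y) (at r within S)"
proof -
  have "((\<lambda>r. (1 / 2) *\<^sub>R (prim f (y + r) - prim f (y - r))) has_vector_derivative
      (1 / 2) *\<^sub>R (1 *\<^sub>R f (y + r) - (- 1) *\<^sub>R f (y - r))) (at r within S)"
    by (rule has_vector_derivative_scaleR[OF DERIV_const, THEN has_vector_derivative_eq_rhs])
      (auto intro!: derivative_eq_intros assms)
  then show ?thesis by (simp add: wave_def mean_def)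
qed

text \<open>The derivative is half the difference of \<open>f1\<close> at \<open>y + r\<close> and
  \<open>y - r\<close>, and \<open>f1\<close> is a primitive of \<open>f2\<close>. Together with
  \<open>wave_has_vector_derivative\<close> it turns two r-derivatives of \<open>wave f\<close> into
  \<open>wave f2\<close>.\<close>

lemma mean_has_vector_derivative:
  assumes "\<And>y. (f has_vector_derivative f1 y) (at y)"
    "\<And>y. (f1 has_vector_derivative f2 y) (at y)" "continuous_on UNIV f2"
  shows "((\<lambda>r. mean f r y) has_vector_derivative wave f2 r y) (at r within S)"
proof -
  have 1: "((\<lambda>r. f (g r)) has_vector_derivative g' *\<^sub>R f1 (g r)) (at r within S)"
    if "(g has_real_derivative g') (at r within S)" for g g' r
    using vector_diff_chain_within[of g g' r S f "f1 (g r)"] that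
      has_vector_derivative_at_within[OF assms(1)]
    by (simp add: o_def has_real_derivative_iff_has_vector_derivative)
  have f1: "f1 z = f1 0 + prim f2 z" for z
  proof -
    have "((\<lambda>z. f1 z - prim f2 z) has_vector_derivative f2 z - f2 z) (at z within UNIV)" for z
      by (intro derivative_intros assms prim_has_vector_derivative)
    then have "(\<lambda>z. f1 z - prim f2 z) constant_on UNIV"
      by (intro has_derivative_zero_constant[unfolded constant_on_def[symmetric]])
        (auto simp: has_vector_derivative_def constant_on_def)
    then have "f1 z - prim f2 z = f1 0 - prim f2 0" unfolding constant_on_def by (metis UNIV_I)
    then show ?thesis by (simp add: algebra_simps)
  qed
  have "((\<lambda>r. (1 / 2) *\<^sub>R (f (y + r) + f (y - r))) has_vector_derivative
      (1 / 2) *\<^sub>R (1 *\<^sub>R f1 (y + r) + (- 1) *\<^sub>R f1 (y - r))) (at r within S)"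
    by (rule has_vector_derivative_scaleR[OF DERIV_const, THEN has_vector_derivative_eq_rhs])
      (auto intro!: derivative_eq_intros 1)
  then show ?thesis by (simp add: wave_def mean_def f1[of "y + r"] f1[of "y - r"])
qed

lemma wave_add:
  assumes "continuous_on UNIV f" "continuous_on UNIV g"
  shows "wave (\<lambda>y. f y + g y) r y = wave f r y + wave g r y"
  by (simp add: wave_def prim_add[OF assms] algebra_simps)

lemma wave_bounded_linear:
  assumes "bounded_linear h" "continuous_on UNIV f"
  shows "wave (\<lambda>y. h (f y)) r y = h (wave f r y)"
proof -
  interpret bounded_linear h by fact
  show ?thesis by (simp add: wave_def prim_bounded_linear[OF assms] diff scaleR)
qed

lemma wave_lipschitz:
  assumes "continuous_on UNIV f" "\<And>x. norm (f x) \<le> B"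
  shows "norm (wave f r y - wave f r' y') \<le> B * (\<bar>r - r'\<bar> + \<bar>y - y'\<bar>)"
proof -
  have B: "0 \<le> B" using order_trans[OF norm_ge_zero assms(2)] .
  have "wave f r y - wave f r' y' = (1 / 2) *\<^sub>R ((prim f (y + r) - prim f (y' + r'))
      - (prim f (y - r) - prim f (y' - r')))"
    by (simp add: wave_def algebra_simps)
  also have "norm \<dots> \<le> 1 / 2 * (norm (prim f (y + r) - prim f (y' + r'))
      + norm (prim f (y - r) - prim f (y' - r')))"
    unfolding norm_scaleR using norm_triangle_ineq4 by simp
  also have "\<dots> \<le> 1 / 2 * (B * \<bar>(y + r) - (y' + r')\<bar> + B * \<bar>(y - r) - (y' - r')\<bar>)"
    by (intro mult_left_mono add_mono prim_lipschitz assms) auto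
  also have "\<dots> = B * ((\<bar>(y + r) - (y' + r')\<bar> + \<bar>(y - r) - (y' - r')\<bar>) / 2)"
    by (simp add: algebra_simps)
  also have "\<dots> \<le> B * (\<bar>r - r'\<bar> + \<bar>y - y'\<bar>)"
    by (intro mult_left_mono B) (auto simp: abs_if)
  finally show ?thesis .
qed

lemma norm_wave_le:
  assumes "continuous_on UNIV f" "\<And>x. norm (f x) \<le> B"
  shows "norm (wave f r y) \<le> B * \<bar>r\<bar>"
  using wave_lipschitz[OF assms, of r y 0 y] by simp

lemma continuous_on_if_nonexpansive:
  fixes f :: "real \<Rightarrow> 'a::metric_space"
  assumes "\<And>x y. dist (f x) (f y) \<le> \<bar>x - y\<bar>"
  shows "continuous_on S f"
proof (rule lipschitz_on_continuous_on[of 1])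
  show "1-lipschitz_on S f" by (rule lipschitz_onI) (use assms in \<open>auto simp: dist_real_def\<close>)
qed

section \<open>The Volterra equation for the functionals\<close>

text \<open>The coefficients are real-linear operators, so that the complex vectors enter as a real
  Euclidean space; complex linearity comes back later as commutation with \<open>J\<close>. They are
  functions on the whole line because the waves also visit negative arguments.\<close>

locale transmutation =
  fixes l :: real and P Q :: "real \<Rightarrow> 'a::euclidean_space \<Rightarrow>\<^sub>L 'a"
  assumes l_pos: "l > 0" and cont_P: "continuous_on UNIV P" and cont_Q: "continuous_on UNIV Q"
begin

lemma l_nonneg: "l \<ge> 0" using l_pos by simp

lemma continuous_on_P_apply:
  "continuous_on S f \<Longrightarrow> continuous_on S (\<lambda>y. blinfun_apply (P y) (f y))"
  by (intro continuous_intros continuous_on_subset[OF cont_P]) auto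

text \<open>Translations do not depend norm-continuously on the shift. The integration in
  \<open>wave\<close> makes this operator Lipschitz in \<open>r\<close>, so that it may stand under
  an integral of operators.\<close>

definition E :: "real \<Rightarrow> (real \<Rightarrow>\<^sub>C 'a) \<Rightarrow>\<^sub>L (real \<Rightarrow>\<^sub>C 'a)" where
  "E r = Blinfun (\<lambda>b. clamped l (wave (apply_bcontfun b) r))"

text \<open>For the same reason evaluation at \<open>y\<close> is taken only after
  \<open>wave\<close>: point evaluations at different points stay far apart in norm, these
  functionals vary continuously with \<open>r\<close> and \<open>y\<close>.\<close>

definition ev :: "real \<Rightarrow> real \<Rightarrow> (real \<Rightarrow>\<^sub>C 'a) \<Rightarrow>\<^sub>L 'a" where
  "ev r y = Blinfun (\<lambda>b. wave (apply_bcontfun b) r y)"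

definition mulP :: "(real \<Rightarrow>\<^sub>C 'a) \<Rightarrow>\<^sub>L (real \<Rightarrow>\<^sub>C 'a)" where
  "mulP = Blinfun (\<lambda>b. clamped l (\<lambda>y. blinfun_apply (P y) (apply_bcontfun b y)))"

lemma ev_apply: "blinfun_apply (ev r y) b = wave (apply_bcontfun b) r y"
proof -
  have "bounded_linear (\<lambda>b::real \<Rightarrow>\<^sub>C 'a. wave (apply_bcontfun b) r y)"
  proof (rule bounded_linear_intro[of _ "\<bar>r\<bar>"])
    show "wave (apply_bcontfun (b + c)) r y = wave (apply_bcontfun b) r y + wave (apply_bcontfun c) r y"
      for b c :: "real \<Rightarrow>\<^sub>C 'a"
      by (simp add: wave_add[symmetric])
    show "wave (apply_bcontfun (a *\<^sub>R b)) r y = a *\<^sub>R wave (apply_bcontfun b) r y"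
      for a and b :: "real \<Rightarrow>\<^sub>C 'a"
      using wave_bounded_linear[OF bounded_linear_scaleR_right[of a], of "apply_bcontfun b"] by simp
    show "norm (wave (apply_bcontfun b) r y) \<le> norm b * \<bar>r\<bar>" for b :: "real \<Rightarrow>\<^sub>C 'a"
      by (rule norm_wave_le) (auto intro: norm_bounded)
  qed
  then show ?thesis by (simp add: ev_def bounded_linear_Blinfun_apply)
qed

lemma E_apply: "blinfun_apply (E r) b = clamped l (wave (apply_bcontfun b) r)"
proof -
  have c: "continuous_on {-l..l} (wave (apply_bcontfun b) r)" for b :: "real \<Rightarrow>\<^sub>C 'a"
    by (rule continuous_on_wave) auto
  have "bounded_linear (\<lambda>b::real \<Rightarrow>\<^sub>C 'a. clamped l (wave (apply_bcontfun b) r))"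
  proof (rule bounded_linear_intro[of _ "\<bar>r\<bar>"])
    show "clamped l (wave (apply_bcontfun (b + d)) r) = clamped l (wave (apply_bcontfun b) r) + clamped l (wave (apply_bcontfun d) r)"
      for b d :: "real \<Rightarrow>\<^sub>C 'a"
    proof -
      have "wave (apply_bcontfun (b + d)) r = (\<lambda>y. wave (apply_bcontfun b) r y + wave (apply_bcontfun d) r y)"
        by (rule ext) (simp add: wave_add)
      then show ?thesis by (simp only: clamped_add c l_nonneg)
    qed
    show "clamped l (wave (apply_bcontfun (a *\<^sub>R b)) r) = a *\<^sub>R clamped l (wave (apply_bcontfun b) r)"
      for a and b :: "real \<Rightarrow>\<^sub>C 'a"
    proof -
      have "wave (apply_bcontfun (a *\<^sub>R b)) r = (\<lambda>y. a *\<^sub>R wave (apply_bcontfun b) r y)"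
        by (rule ext) (simp add: wave_bounded_linear bounded_linear_scaleR_right)
      then show ?thesis by (simp only: clamped_scaleR c l_nonneg)
    qed
    show "norm (clamped l (wave (apply_bcontfun b) r)) \<le> norm b * \<bar>r\<bar>" for b :: "real \<Rightarrow>\<^sub>C 'a"
      by (intro norm_clamped_le l_nonneg c norm_wave_le) (auto intro: norm_bounded)
  qed
  then show ?thesis by (simp add: E_def bounded_linear_Blinfun_apply)
qed

lemma ex_P_bound: "\<exists>p\<ge>0. \<forall>y\<in>{-l..l}. norm (P y) \<le> p"
proof -
  have "bounded (P ` {-l..l})"
    by (intro compact_imp_bounded compact_continuous_image continuous_on_subset[OF cont_P]) auto
  then obtain p where p: "\<forall>z\<in>P ` {-l..l}. norm z \<le> p" by (auto simp: bounded_iff)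
  moreover have "0 \<le> p" using p l_nonneg order_trans[OF norm_ge_zero] by fastforce
  ultimately show ?thesis by auto
qed

lemma ex_Q_bound: "\<exists>q\<ge>0. \<forall>y\<in>{0..l}. norm (Q y) \<le> q"
proof -
  have "bounded (Q ` {0..l})"
    by (intro compact_imp_bounded compact_continuous_image continuous_on_subset[OF cont_Q]) auto
  then obtain q where q: "\<forall>z\<in>Q ` {0..l}. norm z \<le> q" by (auto simp: bounded_iff)
  moreover have "0 \<le> q" using q l_nonneg order_trans[OF norm_ge_zero] by fastforce
  ultimately show ?thesis by auto
qed

lemma mulP_apply: "blinfun_apply mulP b = clamped l (\<lambda>y. blinfun_apply (P y) (apply_bcontfun b y))"
proof -
  have c: "continuous_on {-l..l} (\<lambda>y. blinfun_apply (P y) (apply_bcontfun b y))" for b :: "real \<Rightarrow>\<^sub>C 'a"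
    by (rule continuous_on_P_apply) auto
  obtain p where p: "p \<ge> 0" "\<forall>y\<in>{-l..l}. norm (P y) \<le> p" using ex_P_bound by auto
  have "bounded_linear (\<lambda>b::real \<Rightarrow>\<^sub>C 'a. clamped l (\<lambda>y. blinfun_apply (P y) (apply_bcontfun b y)))"
  proof (rule bounded_linear_intro[of _ p])
    show "clamped l (\<lambda>y. blinfun_apply (P y) (apply_bcontfun (b + d) y))
        = clamped l (\<lambda>y. blinfun_apply (P y) (apply_bcontfun b y)) + clamped l (\<lambda>y. blinfun_apply (P y) (apply_bcontfun d y))"
      for b d :: "real \<Rightarrow>\<^sub>C 'a"
      by (simp add: blinfun.add_right clamped_add c l_nonneg)
    show "clamped l (\<lambda>y. blinfun_apply (P y) (apply_bcontfun (a *\<^sub>R b) y))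
        = a *\<^sub>R clamped l (\<lambda>y. blinfun_apply (P y) (apply_bcontfun b y))"
      for a and b :: "real \<Rightarrow>\<^sub>C 'a"
      by (simp add: blinfun.scaleR_right clamped_scaleR c l_nonneg)
    show "norm (clamped l (\<lambda>y. blinfun_apply (P y) (apply_bcontfun b y))) \<le> norm b * p" for b :: "real \<Rightarrow>\<^sub>C 'a"
    proof (intro norm_clamped_le l_nonneg c)
      fix y assume "\<bar>y\<bar> \<le> l"
      have "norm (blinfun_apply (P y) (apply_bcontfun b y)) \<le> norm (P y) * norm (apply_bcontfun b y)"
        by (rule norm_blinfun)
      also have "\<dots> \<le> p * norm b"
        using p \<open>\<bar>y\<bar> \<le> l\<close> by (intro mult_mono norm_bounded) (auto simp: abs_le_iff)
      finally show "norm (blinfun_apply (P y) (apply_bcontfun b y)) \<le> norm b * p"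
        by (simp add: mult.commute)
    qed
  qed
  then show ?thesis by (simp add: mulP_def bounded_linear_Blinfun_apply)
qed

lemma mulP_clamped:
  assumes "continuous_on UNIV f"
  shows "blinfun_apply mulP (clamped l f) = clamped l (\<lambda>y. blinfun_apply (P y) (f y))"
  unfolding mulP_apply
  by (rule clamped_cong) (use l_nonneg in \<open>auto simp: clamped_apply continuous_on_subset[OF assms]\<close>)

lemma norm_E_le: "norm (E r) \<le> \<bar>r\<bar>"
proof (rule norm_blinfun_bound)
  fix b :: "real \<Rightarrow>\<^sub>C 'a"
  have "norm (clamped l (wave (apply_bcontfun b) r)) \<le> norm b * \<bar>r\<bar>"
    by (intro norm_clamped_le l_nonneg continuous_on_wave norm_wave_le) (auto intro: norm_bounded)
  then show "norm (blinfun_apply (E r) b) \<le> \<bar>r\<bar> * norm b"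
    by (simp add: E_apply mult.commute)
qed auto

lemma norm_ev_le: "norm (ev r y) \<le> \<bar>r\<bar>"
proof (rule norm_blinfun_bound)
  fix b :: "real \<Rightarrow>\<^sub>C 'a"
  have "norm (wave (apply_bcontfun b) r y) \<le> norm b * \<bar>r\<bar>"
    by (intro norm_wave_le) (auto intro: norm_bounded)
  then show "norm (blinfun_apply (ev r y) b) \<le> \<bar>r\<bar> * norm b"
    by (simp add: ev_apply mult.commute)
qed auto

lemma continuous_on_E: "continuous_on S E"
proof (rule continuous_on_if_nonexpansive)
  fix r s
  have c: "continuous_on {-l..l} (wave (apply_bcontfun b) r)" for b :: "real \<Rightarrow>\<^sub>C 'a" and r
    by (rule continuous_on_wave) auto
  show "dist (E r) (E s) \<le> \<bar>r - s\<bar>"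
    unfolding dist_norm
  proof (rule norm_blinfun_bound)
    fix b :: "real \<Rightarrow>\<^sub>C 'a"
    have "norm (wave (apply_bcontfun b) r y - wave (apply_bcontfun b) s y) \<le> norm b * \<bar>r - s\<bar>" for y
      using wave_lipschitz[of "apply_bcontfun b" "norm b" r y s y] norm_bounded[of b] by auto
    then have "dist (clamped l (wave (apply_bcontfun b) r)) (clamped l (wave (apply_bcontfun b) s)) \<le> norm b * \<bar>r - s\<bar>"
      by (intro dist_clamped_le l_nonneg c) (auto simp: dist_norm)
    then show "norm (blinfun_apply (E r - E s) b) \<le> \<bar>r - s\<bar> * norm b"
      by (simp add: blinfun.diff_left E_apply dist_norm mult.commute)
  qed auto
qed

lemma continuous_on_ev: "continuous_on S (\<lambda>(r, y). ev r y)"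
proof -
  have 1: "continuous_on UNIV (\<lambda>z. ev z z)"
  proof (rule continuous_on_if_nonexpansive)
    fix r s
    show "dist (ev r r) (ev s s) \<le> \<bar>r - s\<bar>"
      unfolding dist_norm
    proof (rule norm_blinfun_bound)
      fix b :: "real \<Rightarrow>\<^sub>C 'a"
      have "\<bar>(r + r) - (s + s)\<bar> = 2 * \<bar>r - s\<bar>" by (simp add: abs_if)
      then have "norm (prim (apply_bcontfun b) (r + r) - prim (apply_bcontfun b) (s + s)) \<le> norm b * (2 * \<bar>r - s\<bar>)"
        using prim_lipschitz[of "apply_bcontfun b" "norm b" "r + r" "s + s"] norm_bounded[of b]
        by simp
      then have "norm (wave (apply_bcontfun b) r r - wave (apply_bcontfun b) s s) \<le> norm b * \<bar>r - s\<bar>"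
        by (simp add: wave_def scaleR_diff_right[symmetric])
      then show "norm (blinfun_apply (ev r r - ev s s) b) \<le> \<bar>r - s\<bar> * norm b"
        by (simp add: blinfun.diff_left ev_apply dist_norm mult.commute)
    qed auto
  qed
  have 2: "continuous_on S (\<lambda>p. ev (g p) (g p))" if "continuous_on S g" for g :: "real \<times> real \<Rightarrow> real"
    using continuous_on_compose2[OF 1 that] by simp
  \<comment> \<open>\<open>ev z z\<close> maps \<open>b\<close> to half of
    \<open>prim b (2 * z)\<close>, because \<open>prim\<close> vanishes at 0. The two terms of
    \<open>wave\<close> thus reduce joint continuity to that of a nonexpansive function of one
    variable.\<close>
  have *: "ev r y = ev ((y + r) / 2) ((y + r) / 2) - ev ((y - r) / 2) ((y - r) / 2)" for r y
    by (rule blinfun_eqI) (simp add: blinfun.diff_left ev_apply wave_def scaleR_diff_right)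
  have eq: "(\<lambda>(r, y). ev r y) = (\<lambda>p. ev ((snd p + fst p) / 2) ((snd p + fst p) / 2)
      - ev ((snd p - fst p) / 2) ((snd p - fst p) / 2))"
    unfolding split_beta by (rule ext) (rule *)
  show ?thesis
    unfolding eq by (intro continuous_on_diff 2) (auto intro!: continuous_intros)
qed

text \<open>
  Duhamel's formula for the Goursat problem of the classical kernel, written for functionals: with
  \<open>H x f = f x + K x f\<close> it says that \<open>H x f - f x\<close> is the integral of \<open>Q s (H s g) - H s (P g)\<close> over \<open>s\<close> in
  \<open>{0..x}\<close>, where \<open>g = wave f (x - s)\<close>. No derivative of \<open>P\<close>, \<open>Q\<close> or of a kernel is needed.
\<close>

definition step :: "real \<Rightarrow> real \<Rightarrow> ((real \<Rightarrow>\<^sub>C 'a) \<Rightarrow>\<^sub>L 'a) \<Rightarrow> (real \<Rightarrow>\<^sub>C 'a) \<Rightarrow>\<^sub>L 'a" where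
  "step x s Z = ((Q s - P s) o\<^sub>L ev (x - s) s) + (Q s o\<^sub>L Z o\<^sub>L E (x - s)) - (Z o\<^sub>L mulP o\<^sub>L E (x - s))"

lemma continuous_on_step:
  assumes "continuous_on S x" "continuous_on S s" "continuous_on S Z"
  shows "continuous_on S (\<lambda>p. step (x p) (s p) (Z p))"
proof -
  have 1: "continuous_on S (\<lambda>p. P (s p))" "continuous_on S (\<lambda>p. Q (s p))"
    using continuous_on_compose2[OF cont_P assms(2)] continuous_on_compose2[OF cont_Q assms(2)] by auto
  have 2: "continuous_on S (\<lambda>p. E (x p - s p))"
    by (rule continuous_on_compose2[OF continuous_on_E[of UNIV]]) (auto intro!: continuous_intros assms)
  have "continuous_on S (\<lambda>p. (\<lambda>(r, y). ev r y) (x p - s p, s p))"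
    by (rule continuous_on_compose2[OF continuous_on_ev[of UNIV]]) (auto intro!: continuous_intros assms)
  then have 3: "continuous_on S (\<lambda>p. ev (x p - s p) (s p))" by simp
  show ?thesis
    unfolding step_def by (intro continuous_intros 1 2 3 assms)
qed

text \<open>\<open>step x s Z\<close> is affine in \<open>Z\<close>, and its linear part has norm at
  most \<open>(q + norm mulP) * l\<close> since \<open>norm (E (x - s))\<close> is at most the
  length of the time step \<open>x - s\<close>.\<close>

lemma kernel_ex: "\<exists>Z. continuous_on {0..l} Z \<and> (\<forall>x\<in>{0..l}. Z x = integral {0..x} (\<lambda>s. step x s (Z s)))"
proof -
  obtain p where p: "p \<ge> 0" "\<forall>y\<in>{-l..l}. norm (P y) \<le> p" using ex_P_bound by auto
  obtain q where q: "q \<ge> 0" "\<forall>y\<in>{0..l}. norm (Q y) \<le> q" using ex_Q_bound by auto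
  show ?thesis
  proof (rule volterra_equation_ex[OF l_nonneg, where M = "(q + norm mulP) * l"])
    show "continuous_on (({0..l} \<times> {0..l}) \<times> UNIV) (\<lambda>((x, s), z). step x s z)"
      unfolding split_beta by (rule continuous_on_step) (auto intro!: continuous_intros)
    fix x s and z z' :: "(real \<Rightarrow>\<^sub>C 'a) \<Rightarrow>\<^sub>L 'a" assume xs: "x \<in> {0..l}" "s \<in> {0..l}"
    have E: "norm (E (x - s)) \<le> l" using norm_E_le[of "x - s"] xs by auto
    have "step x s z - step x s z' = (Q s o\<^sub>L (z - z') o\<^sub>L E (x - s)) - ((z - z') o\<^sub>L mulP o\<^sub>L E (x - s))"
      by (rule blinfun_eqI) (simp add: step_def blinfun.diff_left blinfun.diff_right blinfun.add_left)
    also have "norm \<dots> \<le> norm (Q s o\<^sub>L (z - z') o\<^sub>L E (x - s)) + norm ((z - z') o\<^sub>L mulP o\<^sub>L E (x - s))"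
      by (rule norm_triangle_ineq4)
    also have "\<dots> \<le> norm (Q s) * norm (z - z') * norm (E (x - s)) + norm (z - z') * norm mulP * norm (E (x - s))"
      by (intro add_mono order_trans[OF norm_blinfun_compose] mult_right_mono norm_blinfun_compose) auto
    also have "\<dots> \<le> q * norm (z - z') * l + norm (z - z') * norm mulP * l"
      using q xs E by (intro add_mono mult_mono) auto
    finally show "norm (step x s z - step x s z') \<le> (q + norm mulP) * l * norm (z - z')"
      by (simp add: algebra_simps)
  qed
qed

definition K :: "real \<Rightarrow> (real \<Rightarrow>\<^sub>C 'a) \<Rightarrow>\<^sub>L 'a" where
  "K = (SOME Z. continuous_on {0..l} Z \<and> (\<forall>x\<in>{0..l}. Z x = integral {0..x} (\<lambda>s. step x s (Z s))))"

lemma continuous_on_K: "continuous_on {0..l} K"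
  and K_eq_step: "x \<in> {0..l} \<Longrightarrow> K x = integral {0..x} (\<lambda>s. step x s (K s))"
  using someI_ex[OF kernel_ex] unfolding K_def[symmetric] by auto

lemma continuous_on_step_K: "x \<in> {0..l} \<Longrightarrow> continuous_on {0..x} (\<lambda>s. step x s (K s))"
  by (rule continuous_on_step) (auto intro!: continuous_intros continuous_on_subset[OF continuous_on_K])

lemma integrable_step_K: "x \<in> {0..l} \<Longrightarrow> (\<lambda>s. step x s (K s)) integrable_on {0..x}"
  by (intro integrable_continuous_real continuous_on_step_K)

text \<open>This is \<open>Q s (H s g) - H s (P g)\<close> for an arbitrary function
  \<open>g\<close>. In the Duhamel integral the variable x enters the integrand only through
  \<open>g = wave f (x - s)\<close>, so differentiating in x acts on the wave and leaves
  \<open>N s\<close> fixed.\<close>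

definition N :: "real \<Rightarrow> (real \<Rightarrow> 'a) \<Rightarrow> 'a" where
  "N s g = blinfun_apply (Q s - P s) (g s) + blinfun_apply (Q s) (blinfun_apply (K s) (clamped l g))
    - blinfun_apply (K s) (clamped l (\<lambda>y. blinfun_apply (P y) (g y)))"

lemma step_K_apply: "blinfun_apply (step x s (K s)) b = N s (wave (apply_bcontfun b) (x - s))"
  by (simp add: step_def N_def blinfun.diff_left blinfun.add_left E_apply ev_apply mulP_clamped continuous_on_wave)

lemma K_apply:
  assumes "x \<in> {0..l}"
  shows "blinfun_apply (K x) b = integral {0..x} (\<lambda>s. N s (wave (apply_bcontfun b) (x - s)))"
proof -
  have "bounded_linear (\<lambda>Z::(real \<Rightarrow>\<^sub>C 'a) \<Rightarrow>\<^sub>L 'a. blinfun_apply Z b)"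
    by (rule blinfun.bounded_linear_left)
  from integral_linear[OF integrable_step_K[OF assms] this]
  show ?thesis unfolding K_eq_step[OF assms] by (simp add: o_def step_K_apply)
qed

lemma K_0: "K 0 = 0"
  using K_eq_step[of 0] l_nonneg by simp

text \<open>The source term contributes \<open>norm (Q s - P s)\<close>, the two feedback terms
  contribute \<open>norm (K s)\<close>; every factor \<open>E\<close> or \<open>ev\<close> costs at
  most \<open>l\<close>. Keeping \<open>Q - P\<close> visible lets the later bound of
  \<open>Q - P\<close> by \<open>K\<close> close the estimate.\<close>

lemma norm_K_le:
  shows "\<exists>c\<ge>0. \<forall>x\<in>{0..l}. norm (K x) \<le> integral {0..x} (\<lambda>s. c * (norm (Q s - P s) + norm (K s)))"
proof -
  obtain q where q: "q \<ge> 0" "\<forall>y\<in>{0..l}. norm (Q y) \<le> q" using ex_Q_bound by auto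
  define c where "c = (1 + q + norm mulP) * l"
  have c0: "c \<ge> 0" using q l_nonneg by (simp add: c_def)
  have "norm (K x) \<le> integral {0..x} (\<lambda>s. c * (norm (Q s - P s) + norm (K s)))" if x: "x \<in> {0..l}" for x
    unfolding K_eq_step[OF x]
  proof (rule integral_norm_bound_integral[OF integrable_step_K[OF x]])
    show "(\<lambda>s. c * (norm (Q s - P s) + norm (K s))) integrable_on {0..x}"
      using x by (intro integrable_continuous_real continuous_intros
          continuous_on_subset[OF cont_P] continuous_on_subset[OF cont_Q] continuous_on_subset[OF continuous_on_K]) auto
    fix s assume s: "s \<in> {0..x}"
    have E: "norm (E (x - s)) \<le> l" using norm_E_le[of "x - s"] x s by auto
    have ev: "norm (ev (x - s) s) \<le> l" using norm_ev_le[of "x - s" s] x s by auto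
    have "norm (step x s (K s)) \<le> norm ((Q s - P s) o\<^sub>L ev (x - s) s) + norm (Q s o\<^sub>L K s o\<^sub>L E (x - s))
        + norm (K s o\<^sub>L mulP o\<^sub>L E (x - s))"
      unfolding step_def by (rule order_trans[OF norm_triangle_ineq4 add_right_mono[OF norm_triangle_ineq]])
    also have "\<dots> \<le> norm (Q s - P s) * norm (ev (x - s) s) + norm (Q s) * norm (K s) * norm (E (x - s))
        + norm (K s) * norm mulP * norm (E (x - s))"
      by (intro add_mono order_trans[OF norm_blinfun_compose] mult_right_mono norm_blinfun_compose) auto
    also have "\<dots> \<le> norm (Q s - P s) * l + q * norm (K s) * l + norm (K s) * norm mulP * l"
      using q x s E ev by (intro add_mono mult_mono) auto
    also have "\<dots> \<le> c * norm (Q s - P s) + c * norm (K s)"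
      using mult_nonneg_nonneg[OF l_nonneg norm_ge_zero[of "Q s - P s"]] q(1) l_nonneg
      by (simp add: c_def algebra_simps)
    finally show "norm (step x s (K s)) \<le> c * (norm (Q s - P s) + norm (K s))"
      by (simp add: algebra_simps)
  qed
  then show ?thesis using c0 by blast
qed

section \<open>Uniqueness for the homogeneous equation, with locality and commutation as
  consequences\<close>

text \<open>Iterating the equation n times bounds the value by \<open>(M * x) ^ n / fact n\<close>.
  The estimate is made for each \<open>b\<close> separately, since the equation may hold only on the
  sets \<open>V x\<close>; these must be stable under the two operators that the iteration applies
  to \<open>b\<close>. The uses take functions vanishing on \<open>{-x..x}\<close> and all
  functions.\<close>

lemma volterra_unique:
  assumes cont: "continuous_on {0..l} C"
    and V: "\<And>x s b. b \<in> V x \<Longrightarrow> s \<in> {0..x} \<Longrightarrow> x \<in> {0..l} \<Longrightarrow>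
      blinfun_apply (E (x - s)) b \<in> V s \<and> blinfun_apply mulP (blinfun_apply (E (x - s)) b) \<in> V s"
    and eq: "\<And>x b. b \<in> V x \<Longrightarrow> x \<in> {0..l} \<Longrightarrow> blinfun_apply (C x) b =
      integral {0..x} (\<lambda>s. blinfun_apply (Q s) (blinfun_apply (C s) (blinfun_apply (E (x - s)) b))
        - blinfun_apply (C s) (blinfun_apply mulP (blinfun_apply (E (x - s)) b)))"
    and x: "x \<in> {0..l}" and b: "b \<in> V x"
  shows "blinfun_apply (C x) b = 0"
proof -
  obtain q where q: "q \<ge> 0" "\<forall>y\<in>{0..l}. norm (Q y) \<le> q" using ex_Q_bound by auto
  have "bounded (C ` {0..l})" by (intro compact_imp_bounded compact_continuous_image cont) auto
  then obtain A where A: "\<forall>z\<in>C ` {0..l}. norm z \<le> A" by (auto simp: bounded_iff)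
  have A0: "0 \<le> A" using A l_nonneg order_trans[OF norm_ge_zero] by fastforce
  define M where "M = (q + norm mulP) * l"
  have M: "M \<ge> 0" using q l_nonneg by (simp add: M_def)
  have bound: "norm (blinfun_apply (C x) b) \<le> A * norm b * (M * x) ^ n / fact n"
    if "x \<in> {0..l}" "b \<in> V x" for n x b
    using that
  proof (induction n arbitrary: x b)
    case 0
    have "norm (blinfun_apply (C x) b) \<le> norm (C x) * norm b" by (rule norm_blinfun)
    also have "\<dots> \<le> A * norm b" using A 0 by (intro mult_right_mono) auto
    finally show ?case by simp
  next
    case (Suc n)
    let ?f = "\<lambda>s. blinfun_apply (Q s) (blinfun_apply (C s) (blinfun_apply (E (x - s)) b))
        - blinfun_apply (C s) (blinfun_apply mulP (blinfun_apply (E (x - s)) b))"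
    let ?B = "\<lambda>s. (A * norm b * M ^ Suc n / fact n) * s ^ n"
    have hi: "(?B has_integral (A * norm b * M ^ Suc n / fact n) * (x ^ Suc n / (1 + n) - 0 ^ Suc n / (1 + n))) {0..x}"
      using Suc.prems by (intro has_integral_mult_right fundamental_theorem_of_calculus)
        (auto intro!: derivative_eq_intros simp: has_real_derivative_iff_has_vector_derivative[symmetric] simp del: power_Suc)
    have "norm (blinfun_apply (C x) b) = norm (integral {0..x} ?f)"
      using eq[OF Suc.prems(2,1)] by simp
    also have "\<dots> \<le> integral {0..x} ?B"
    proof (rule integral_norm_bound_integral)
      have cE: "continuous_on {0..x} (\<lambda>s. blinfun_apply (E (x - s)) b)"
        by (intro continuous_intros continuous_on_compose2[OF continuous_on_E[of UNIV]]) auto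
      show "?f integrable_on {0..x}"
        using Suc.prems by (intro integrable_continuous_real continuous_intros cE
            continuous_on_subset[OF cont_Q] continuous_on_subset[OF cont]) auto
      show "?B integrable_on {0..x}" using hi by auto
      fix s assume s: "s \<in> {0..x}"
      let ?e = "blinfun_apply (E (x - s)) b"
      have s': "s \<in> {0..l}" using s Suc.prems by auto
      have e: "norm ?e \<le> l * norm b"
        by (rule order_trans[OF norm_blinfun], rule mult_right_mono[OF order_trans[OF norm_E_le]])
          (use s Suc.prems in auto)
      define D where "D = A * (M * s) ^ n / fact n"
      have D: "D \<ge> 0" using A0 M s by (simp add: D_def)
      have IH: "norm (blinfun_apply (C s) b') \<le> D * norm b'" if "b' \<in> V s" for b'
        using Suc.IH[OF s' that] by (simp add: D_def mult_ac)
      note Vs = V[OF Suc.prems(2) s Suc.prems(1)]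
      have "norm (?f s) \<le> norm (blinfun_apply (Q s) (blinfun_apply (C s) ?e)) + norm (blinfun_apply (C s) (blinfun_apply mulP ?e))"
        by (rule norm_triangle_ineq4)
      also have "\<dots> \<le> q * (D * norm ?e) + D * (norm mulP * norm ?e)"
      proof (rule add_mono)
        show "norm (blinfun_apply (Q s) (blinfun_apply (C s) ?e)) \<le> q * (D * norm ?e)"
          by (rule order_trans[OF norm_blinfun]) (use q s' IH Vs in \<open>auto intro!: mult_mono\<close>)
        show "norm (blinfun_apply (C s) (blinfun_apply mulP ?e)) \<le> D * (norm mulP * norm ?e)"
          using Vs D by (intro order_trans[OF IH] mult_left_mono norm_blinfun) auto
      qed
      also have "\<dots> = D * (q + norm mulP) * norm ?e" by (simp add: algebra_simps)
      also have "\<dots> \<le> D * (q + norm mulP) * (l * norm b)"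
        using D q e by (intro mult_left_mono) auto
      also have "\<dots> = ?B s" by (simp add: D_def M_def power_mult_distrib)
      finally show "norm (?f s) \<le> ?B s" .
    qed
    also have "\<dots> = A * norm b * (M * x) ^ Suc n / fact (Suc n)"
      unfolding integral_unique[OF hi] by (simp add: power_mult_distrib mult_ac)
    finally show ?case .
  qed
  have "(\<lambda>n. A * norm b * ((M * x) ^ n / fact n)) \<longlonglongrightarrow> A * norm b * 0"
    by (intro tendsto_mult tendsto_const) (use summable_LIMSEQ_zero[OF summable_exp[of "M * x"]] in \<open>simp add: field_simps\<close>)
  then have "norm (blinfun_apply (C x) b) \<le> 0"
    by (intro LIMSEQ_le_const[of _ 0]) (use bound[OF x b] in auto)
  then show ?thesis by simp
qed

text \<open>Finite speed of propagation: vanishing on \<open>{-x..x}\<close> is passed on to \<open>E (x - s) b\<close> on \<open>{-s..s}\<close>.\<close>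

lemma K_local:
  assumes x: "x \<in> {0..l}" and b: "\<And>y. \<bar>y\<bar> \<le> x \<Longrightarrow> apply_bcontfun b y = apply_bcontfun b' y"
  shows "blinfun_apply (K x) b = blinfun_apply (K x) b'"
proof -
  define V where "V x = {b :: real \<Rightarrow>\<^sub>C 'a. \<forall>y. \<bar>y\<bar> \<le> x \<longrightarrow> apply_bcontfun b y = 0}" for x
  have wave0: "wave (apply_bcontfun b) (x - s) y = 0"
    if "b \<in> V x" "\<bar>y\<bar> \<le> s" "s \<in> {0..x}" for b x s y
  proof -
    have "prim (apply_bcontfun b) z = prim (\<lambda>_. 0) z" if "\<bar>z\<bar> \<le> x" for z
      by (rule prim_cong) (use that \<open>b \<in> V x\<close> in \<open>auto simp: V_def\<close>)
    then have "prim (apply_bcontfun b) (y + (x - s)) = 0" "prim (apply_bcontfun b) (y - (x - s)) = 0"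
      using that by (auto simp: prim_def[of "\<lambda>_. 0"] abs_le_iff)
    then show ?thesis by (simp add: wave_def)
  qed
  have Vs: "blinfun_apply (E (x - s)) b \<in> V s" "blinfun_apply mulP (blinfun_apply (E (x - s)) b) \<in> V s"
    if "b \<in> V x" "s \<in> {0..x}" "x \<in> {0..l}" for b x s
    using wave0[OF that(1) _ that(2)] that l_nonneg
    by (auto simp: V_def E_apply mulP_clamped continuous_on_wave clamped_apply continuous_on_P_apply)
  have "blinfun_apply (K x) (b - b') = 0"
  proof (rule volterra_unique[OF continuous_on_K _ _ x, where V = V])
    show "b - b' \<in> V x" using b by (simp add: V_def)
    fix x :: real and b assume bx: "b \<in> V x" "x \<in> {0..l}"
    show "blinfun_apply (K x) b = integral {0..x} (\<lambda>s. blinfun_apply (Q s) (blinfun_apply (K s) (blinfun_apply (E (x - s)) b))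
        - blinfun_apply (K s) (blinfun_apply mulP (blinfun_apply (E (x - s)) b)))"
      unfolding K_apply[OF bx(2)]
    proof (rule integral_cong)
      fix s assume "s \<in> {0..x}"
      \<comment> \<open>The source term with \<open>Q s - P s\<close> drops out for such
        \<open>b\<close>, which leaves the homogeneous equation.\<close>
      then have "wave (apply_bcontfun b) (x - s) s = 0" using wave0[OF bx(1)] by auto
      then show "N s (wave (apply_bcontfun b) (x - s)) = blinfun_apply (Q s) (blinfun_apply (K s) (blinfun_apply (E (x - s)) b))
        - blinfun_apply (K s) (blinfun_apply mulP (blinfun_apply (E (x - s)) b))"
        by (simp add: N_def E_apply mulP_clamped continuous_on_wave)
    qed
  qed (use Vs in auto)
  then show ?thesis by (simp add: blinfun.diff_right)
qed

text \<open>For \<open>y\<close> in \<open>{-s..s}\<close> the wave at step \<open>x - s\<close>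
  reads \<open>f\<close> only on \<open>{-x..x}\<close>, where clamping changes nothing, and
  \<open>K s\<close> ignores the rest by \<open>K_local\<close>. The formula thus contains the
  smooth \<open>f\<close> itself, whereas its clamped version in general has kinks at the
  ends.\<close>

lemma K_clamped:
  assumes x: "x \<in> {0..l}" and f: "continuous_on UNIV f"
  shows "blinfun_apply (K x) (clamped l f) = integral {0..x} (\<lambda>s. N s (wave f (x - s)))"
  unfolding K_apply[OF x]
proof (rule integral_cong)
  fix s assume s: "s \<in> {0..x}"
  have f': "continuous_on {-l..l} f" by (rule continuous_on_subset[OF f]) auto
  have eq: "wave (apply_bcontfun (clamped l f)) (x - s) y = wave f (x - s) y" if "\<bar>y\<bar> \<le> s" for y
  proof -
    have "prim (apply_bcontfun (clamped l f)) z = prim f z" if "\<bar>z\<bar> \<le> x" for z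
      by (rule prim_cong) (use that x in \<open>auto simp: clamped_apply l_nonneg f'\<close>)
    then have "prim (apply_bcontfun (clamped l f)) (y + (x - s)) = prim f (y + (x - s))"
        "prim (apply_bcontfun (clamped l f)) (y - (x - s)) = prim f (y - (x - s))"
      using that s by (auto simp: abs_le_iff)
    then show ?thesis by (simp add: wave_def)
  qed
  have w: "continuous_on S (wave (apply_bcontfun (clamped l f)) r)" "continuous_on S (wave f r)" for S r
    by (auto intro: continuous_on_wave f)
  have sl: "s \<in> {0..l}" using s x by auto
  have "blinfun_apply (K s) (clamped l (wave (apply_bcontfun (clamped l f)) (x - s))) = blinfun_apply (K s) (clamped l (wave f (x - s)))"
    by (rule K_local[OF sl]) (use sl in \<open>auto simp: clamped_apply l_nonneg w eq\<close>)
  moreover have "blinfun_apply (K s) (clamped l (\<lambda>y. blinfun_apply (P y) (wave (apply_bcontfun (clamped l f)) (x - s) y)))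
      = blinfun_apply (K s) (clamped l (\<lambda>y. blinfun_apply (P y) (wave f (x - s) y)))"
    by (rule K_local[OF sl]) (use sl in \<open>auto simp: clamped_apply l_nonneg w eq continuous_on_P_apply\<close>)
  ultimately show "N s (wave (apply_bcontfun (clamped l f)) (x - s)) = N s (wave f (x - s))"
    using eq[of s] s by (simp add: N_def)
qed

end

context transmutation
begin

text \<open>The commutator of \<open>K\<close> with pointwise application of \<open>J\<close>
  satisfies the homogeneous Volterra equation: its source term cancels because \<open>J\<close>
  commutes with \<open>Q s - P s\<close>. Hence \<open>volterra_unique\<close> applies with all
  functions allowed.\<close>

lemma K_commute:
  fixes J :: "'a \<Rightarrow>\<^sub>L 'a"
  assumes JP: "\<And>y. J o\<^sub>L P y = P y o\<^sub>L J" and JQ: "\<And>y. J o\<^sub>L Q y = Q y o\<^sub>L J"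
    and x: "x \<in> {0..l}" and f: "continuous_on UNIV f"
  shows "blinfun_apply (K x) (clamped l (\<lambda>y. blinfun_apply J (f y))) = blinfun_apply J (blinfun_apply (K x) (clamped l f))"
proof -
  have JP': "blinfun_apply J (blinfun_apply (P y) z) = blinfun_apply (P y) (blinfun_apply J z)" for y z
    using JP[of y] by (metis blinfun_apply_blinfun_compose)
  have JQ': "blinfun_apply J (blinfun_apply (Q y) z) = blinfun_apply (Q y) (blinfun_apply J z)" for y z
    using JQ[of y] by (metis blinfun_apply_blinfun_compose)
  define mulJ :: "(real \<Rightarrow>\<^sub>C 'a) \<Rightarrow>\<^sub>L (real \<Rightarrow>\<^sub>C 'a)" where
    "mulJ = Blinfun (\<lambda>b. Bcontfun (\<lambda>y. blinfun_apply J (apply_bcontfun b y)))"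
  have le: "norm (blinfun_apply J (apply_bcontfun b y)) \<le> norm b * norm J" for b :: "real \<Rightarrow>\<^sub>C 'a" and y
    using norm_blinfun[of J "apply_bcontfun b y"] mult_left_mono[OF norm_bounded norm_ge_zero, of J b y]
    by (simp add: mult.commute)
  have app: "apply_bcontfun (Bcontfun (\<lambda>y. blinfun_apply J (apply_bcontfun b y))) y = blinfun_apply J (apply_bcontfun b y)"
    for b :: "real \<Rightarrow>\<^sub>C 'a" and y
    by (subst Bcontfun_inverse[OF bcontfun_normI]) (auto intro!: continuous_intros le)
  have "bounded_linear (\<lambda>b::real \<Rightarrow>\<^sub>C 'a. Bcontfun (\<lambda>y. blinfun_apply J (apply_bcontfun b y)))"
  proof (rule bounded_linear_intro[of _ "norm J"])
    show "norm (Bcontfun (\<lambda>y. blinfun_apply J (apply_bcontfun b y))) \<le> norm b * norm J" for b :: "real \<Rightarrow>\<^sub>C 'a"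
      by (rule norm_bound) (simp add: app le)
    show "Bcontfun (\<lambda>y. blinfun_apply J (apply_bcontfun (b + d) y))
        = Bcontfun (\<lambda>y. blinfun_apply J (apply_bcontfun b y)) + Bcontfun (\<lambda>y. blinfun_apply J (apply_bcontfun d y))"
      for b d :: "real \<Rightarrow>\<^sub>C 'a"
      by (rule bcontfun_eqI, subst app) (simp add: app blinfun.add_right)
    show "Bcontfun (\<lambda>y. blinfun_apply J (apply_bcontfun (a *\<^sub>R b) y))
        = a *\<^sub>R Bcontfun (\<lambda>y. blinfun_apply J (apply_bcontfun b y))"
      for a and b :: "real \<Rightarrow>\<^sub>C 'a"
      by (rule bcontfun_eqI, subst app) (simp add: app blinfun.scaleR_right)
  qed
  then have mulJ: "apply_bcontfun (blinfun_apply mulJ b) y = blinfun_apply J (apply_bcontfun b y)" for b y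
    by (simp add: mulJ_def bounded_linear_Blinfun_apply app)
  then have mulJ': "apply_bcontfun (blinfun_apply mulJ b) = (\<lambda>y. blinfun_apply J (apply_bcontfun b y))" for b
    by auto
  have evJ: "wave (\<lambda>y. blinfun_apply J (apply_bcontfun b y)) r y = blinfun_apply J (wave (apply_bcontfun b) r y)" for b r y
    by (rule wave_bounded_linear) (auto intro: blinfun.bounded_linear_right)
  have clJ: "clamped l (\<lambda>y. blinfun_apply J (g y)) = blinfun_apply mulJ (clamped l g)" if "continuous_on {-l..l} g" for g
    by (rule bcontfun_eqI) (simp add: mulJ clamped_apply l_nonneg that continuous_intros)
  have EJ: "blinfun_apply (E r) (blinfun_apply mulJ b) = blinfun_apply mulJ (blinfun_apply (E r) b)" for r b
    by (simp add: E_apply mulJ' evJ[abs_def] clJ continuous_on_wave)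
  have PJ: "blinfun_apply mulP (blinfun_apply mulJ b) = blinfun_apply mulJ (blinfun_apply mulP b)" for b
    by (simp add: mulP_apply mulJ' JP'[symmetric] clJ continuous_on_P_apply)
  have "blinfun_apply ((J o\<^sub>L K x) - (K x o\<^sub>L mulJ)) (clamped l f) = 0"
  proof (rule volterra_unique[where V = "\<lambda>_. UNIV", OF _ _ _ x])
    show "continuous_on {0..l} (\<lambda>x. (J o\<^sub>L K x) - (K x o\<^sub>L mulJ))"
      by (intro continuous_intros continuous_on_K)
    fix x :: real and b assume x: "x \<in> {0..l}"
    have int: "(\<lambda>s. blinfun_apply (step x s (K s)) b) integrable_on {0..x}" for b
      by (intro integrable_continuous_real continuous_intros continuous_on_step_K x)
    have K_int: "blinfun_apply (K x) b = integral {0..x} (\<lambda>s. blinfun_apply (step x s (K s)) b)" for b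
      by (simp add: K_apply[OF x] step_K_apply)
    have "blinfun_apply ((J o\<^sub>L K x) - (K x o\<^sub>L mulJ)) b
        = blinfun_apply J (blinfun_apply (K x) b) - blinfun_apply (K x) (blinfun_apply mulJ b)"
      by (simp add: blinfun.diff_left)
    also have "blinfun_apply J (blinfun_apply (K x) b) = integral {0..x} (\<lambda>s. blinfun_apply J (blinfun_apply (step x s (K s)) b))"
      using integral_linear[OF int, of "blinfun_apply J"] by (simp add: K_int o_def blinfun.bounded_linear_right)
    also have "\<dots> - blinfun_apply (K x) (blinfun_apply mulJ b)
        = integral {0..x} (\<lambda>s. blinfun_apply J (blinfun_apply (step x s (K s)) b) - blinfun_apply (step x s (K s)) (blinfun_apply mulJ b))"
      unfolding K_int
      by (rule integral_diff[symmetric])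
        (intro integrable_continuous_real continuous_intros continuous_on_step_K x)+
    also have "\<dots> = integral {0..x} (\<lambda>s. blinfun_apply (Q s) (blinfun_apply ((J o\<^sub>L K s) - (K s o\<^sub>L mulJ)) (blinfun_apply (E (x - s)) b))
        - blinfun_apply ((J o\<^sub>L K s) - (K s o\<^sub>L mulJ)) (blinfun_apply mulP (blinfun_apply (E (x - s)) b)))"
      by (rule integral_cong)
        (simp add: step_def blinfun.diff_left blinfun.add_left blinfun.diff_right blinfun.add_right
          EJ PJ JQ' JP' ev_apply mulJ' evJ)
    finally show "blinfun_apply ((J o\<^sub>L K x) - (K x o\<^sub>L mulJ)) b = \<dots>" .
  qed auto
  then show ?thesis
    by (simp add: blinfun.diff_left clJ continuous_on_subset[OF f])
qed

section \<open>Derivatives in x and the intertwining relation\<close>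

lemma continuous_on_N:
  assumes g: "continuous_on UNIV (\<lambda>(r, y). g r y)"
  shows "continuous_on ({0..l} \<times> {0..l}) (\<lambda>(x, s). N s (g (x - s)))"
proof -
  have s: "continuous_on ({0..l} \<times> {0..l}) (\<lambda>p::real \<times> real. snd p)" by (intro continuous_intros)
  have 1: "continuous_on ({0..l} \<times> {0..l}) (\<lambda>p. P (snd p))" "continuous_on ({0..l} \<times> {0..l}) (\<lambda>p. Q (snd p))"
    "continuous_on ({0..l} \<times> {0..l}) (\<lambda>p. K (snd p))"
    by (rule continuous_on_compose2[OF cont_P s] continuous_on_compose2[OF cont_Q s]
        continuous_on_compose2[OF continuous_on_K s], auto)+
  have 2: "continuous_on ({0..l} \<times> {0..l}) (\<lambda>p. g (fst p - snd p) (snd p))"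
    using continuous_on_compose2[OF g, of "{0..l} \<times> {0..l}" "\<lambda>p. (fst p - snd p, snd p)"]
    by (simp add: continuous_intros)
  have g': "continuous_on UNIV (\<lambda>q::(real \<times> real) \<times> real. g (fst (fst q) - snd (fst q)) (snd q))"
    using continuous_on_compose2[OF g, of UNIV "\<lambda>q. (fst (fst q) - snd (fst q), snd q)"]
    by (simp add: continuous_intros)
  have 3: "continuous_on ({0..l} \<times> {0..l}) (\<lambda>p. clamped l (g (fst p - snd p)))"
    by (rule continuous_on_clamped[OF l_nonneg]) (simp add: split_beta continuous_on_subset[OF g'])
  have 4: "continuous_on ({0..l} \<times> {0..l}) (\<lambda>p. clamped l (\<lambda>y. blinfun_apply (P y) (g (fst p - snd p) y)))"
    by (rule continuous_on_clamped[OF l_nonneg])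
      (auto simp: split_beta intro!: continuous_intros continuous_on_subset[OF g'] continuous_on_compose2[OF cont_P])
  show ?thesis
    unfolding N_def split_beta by (intro continuous_intros 1 2 3 4)
qed

lemma N_has_vector_derivative:
  assumes g: "continuous_on UNIV (\<lambda>(r, y). g r y)" and g': "continuous_on UNIV (\<lambda>(r, y). g' r y)"
    and deriv: "\<And>r y. ((\<lambda>r. g r y) has_vector_derivative g' r y) (at r)"
  shows "((\<lambda>x. N s (g (x - s))) has_vector_derivative N s (g' (x - s))) (at x within S)"
proof -
  have c: "continuous_on UNIV (\<lambda>(x, y). k (x - s) y)" if "continuous_on UNIV (\<lambda>(r, y). k r y)" for k :: "real \<Rightarrow> real \<Rightarrow> 'a"
    using continuous_on_compose2[OF that, of UNIV "\<lambda>p. (fst p - s, snd p)"]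
    by (simp add: continuous_intros split_beta)
  have d: "((\<lambda>x. g (x - s) y) has_vector_derivative g' (x - s) y) (at x within S)" for x y S
    using vector_diff_chain_within[of "\<lambda>x. x - s" 1 x S "\<lambda>r. g r y" "g' (x - s) y"]
      has_vector_derivative_at_within[OF deriv]
    by (simp add: o_def has_vector_derivative_diff_const)
  have 1: "((\<lambda>x. clamped l (g (x - s))) has_vector_derivative clamped l (g' (x - s))) (at x within S)"
    by (rule has_vector_derivative_at_within, rule clamped_has_vector_derivative)
      (use l_nonneg d continuous_on_subset[OF c[OF g]] continuous_on_subset[OF c[OF g']] in auto)
  have cP: "continuous_on T (\<lambda>(x, y). blinfun_apply (P y) (k (x - s) y))"
    if "continuous_on UNIV (\<lambda>(r, y). k r y)" for k :: "real \<Rightarrow> real \<Rightarrow> 'a" and T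
    using continuous_on_subset[OF c[OF that], of T] unfolding split_beta
    by (intro continuous_intros continuous_on_compose2[OF cont_P]) auto
  have 2: "((\<lambda>x. clamped l (\<lambda>y. blinfun_apply (P y) (g (x - s) y))) has_vector_derivative
      clamped l (\<lambda>y. blinfun_apply (P y) (g' (x - s) y))) (at x within S)"
    by (rule has_vector_derivative_at_within, rule clamped_has_vector_derivative)
      (use l_nonneg cP[OF g] cP[OF g'] bounded_linear.has_vector_derivative[OF blinfun.bounded_linear_right d] in auto)
  show ?thesis
    unfolding N_def
    by (intro derivative_intros bounded_linear.has_vector_derivative[OF blinfun.bounded_linear_right] 1 2 d)
qed

text \<open>With \<open>H x f = f x + K x f\<close> the last equation is the intertwining
  \<open>(H f)'' - Q (H f) = H (f'' - P f)\<close>. The first derivative of the Duhamel integral has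
  no boundary term because \<open>wave f 0 = 0\<close>. In the second, \<open>mean f 0 = f\<close>
  gives the boundary term \<open>N x f\<close>, that is \<open>Q (H f) - H (P f)\<close>, and the
  remaining integral is \<open>K x\<close> applied to \<open>f2\<close>.\<close>

lemma transmutation_derivatives:
  assumes f1: "\<And>y. (f has_vector_derivative f1 y) (at y)"
    and f2: "\<And>y. (f1 has_vector_derivative f2 y) (at y)" and cont: "continuous_on UNIV f2"
  obtains h1 where "h1 0 = f1 0"
    and "\<forall>x\<in>{0..l}. ((\<lambda>x. f x + blinfun_apply (K x) (clamped l f)) has_vector_derivative h1 x) (at x within {0..l})"
    and "\<forall>x\<in>{0..l}. (h1 has_vector_derivative
      blinfun_apply (Q x) (f x + blinfun_apply (K x) (clamped l f)) + (f2 x - blinfun_apply (P x) (f x))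
        + blinfun_apply (K x) (clamped l (\<lambda>y. f2 y - blinfun_apply (P y) (f y)))) (at x within {0..l})"
proof -
  have cf: "continuous_on UNIV f"
    using f1 has_vector_derivative_continuous by (force simp: continuous_on_eq_continuous_within)
  define \<Phi> where "\<Phi> x = integral {0..x} (\<lambda>s. N s (mean f (x - s)))" for x
  have N_wave_0: "N x (wave g 0) = 0" for x and g :: "real \<Rightarrow> 'a"
  proof -
    have "wave g 0 = (\<lambda>_. 0)" by (rule ext) simp
    moreover have "clamped l (\<lambda>_. 0 :: 'a) = 0" by (rule bcontfun_eqI) (simp add: clamped_apply l_nonneg)
    ultimately show ?thesis by (simp add: N_def)
  qed
  have "mean f 0 = f" by (rule ext) simp
  show thesis
  proof (rule that[of "\<lambda>x. f1 x + \<Phi> x"])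
    show "f1 0 + \<Phi> 0 = f1 0" by (simp add: \<Phi>_def)
    show "\<forall>x\<in>{0..l}. ((\<lambda>x. f x + blinfun_apply (K x) (clamped l f)) has_vector_derivative f1 x + \<Phi> x) (at x within {0..l})"
    proof
      fix x assume x: "x \<in> {0..l}"
      have "((\<lambda>x. integral {0..x} (\<lambda>s. N s (wave f (x - s)))) has_vector_derivative
          N x (wave f (x - x)) + integral {0..x} (\<lambda>s. N s (mean f (x - s)))) (at x within {0..l})"
        by (rule volterra_has_vector_derivative)
          (intro continuous_on_N N_has_vector_derivative continuous_on_wave2 continuous_on_mean2
            wave_has_vector_derivative cf x)+
      then have "((\<lambda>x. blinfun_apply (K x) (clamped l f)) has_vector_derivative \<Phi> x) (at x within {0..l})"
        by (intro has_vector_derivative_transform[OF x K_clamped[OF _ cf]]) (simp_all add: \<Phi>_def N_wave_0)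
      then show "((\<lambda>x. f x + blinfun_apply (K x) (clamped l f)) has_vector_derivative f1 x + \<Phi> x) (at x within {0..l})"
        by (intro derivative_intros has_vector_derivative_at_within[OF f1])
    qed
    show "\<forall>x\<in>{0..l}. ((\<lambda>x. f1 x + \<Phi> x) has_vector_derivative
        blinfun_apply (Q x) (f x + blinfun_apply (K x) (clamped l f)) + (f2 x - blinfun_apply (P x) (f x))
          + blinfun_apply (K x) (clamped l (\<lambda>y. f2 y - blinfun_apply (P y) (f y)))) (at x within {0..l})"
    proof
      fix x assume x: "x \<in> {0..l}"
      have "(\<Phi> has_vector_derivative N x (mean f (x - x)) + integral {0..x} (\<lambda>s. N s (wave f2 (x - s)))) (at x within {0..l})"
        unfolding \<Phi>_def
        by (rule volterra_has_vector_derivative)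
          (intro continuous_on_N N_has_vector_derivative continuous_on_wave2 continuous_on_mean2
            mean_has_vector_derivative[OF f1 f2] cf cont x)+
      then have \<Phi>: "(\<Phi> has_vector_derivative N x f + blinfun_apply (K x) (clamped l f2)) (at x within {0..l})"
        by (simp add: K_clamped[OF x cont] \<open>mean f 0 = f\<close>)
      have "clamped l (\<lambda>y. f2 y - blinfun_apply (P y) (f y)) = clamped l f2 - clamped l (\<lambda>y. blinfun_apply (P y) (f y))"
        by (rule clamped_diff) (auto intro: l_nonneg continuous_on_P_apply continuous_on_subset[OF cf] continuous_on_subset[OF cont])
      then have "f2 x + (N x f + blinfun_apply (K x) (clamped l f2))
          = blinfun_apply (Q x) (f x + blinfun_apply (K x) (clamped l f)) + (f2 x - blinfun_apply (P x) (f x))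
            + blinfun_apply (K x) (clamped l (\<lambda>y. f2 y - blinfun_apply (P y) (f y)))"
        by (simp add: N_def blinfun.diff_left blinfun.diff_right blinfun.add_right)
      with has_vector_derivative_add[OF has_vector_derivative_at_within[OF f2] \<Phi>]
      show "((\<lambda>x. f1 x + \<Phi> x) has_vector_derivative
          blinfun_apply (Q x) (f x + blinfun_apply (K x) (clamped l f)) + (f2 x - blinfun_apply (P x) (f x))
            + blinfun_apply (K x) (clamped l (\<lambda>y. f2 y - blinfun_apply (P y) (f y)))) (at x within {0..l})"
        by simp
    qed
  qed
qed

end

section \<open>Unique continuation in the space variable\<close>

text \<open>Taylor's formula with integral remainder, from the antiderivative
  \<open>(x - y) g1(y) + g(y)\<close>. It rewrites the second-order problem with zero Cauchy data as
  an integral equation.\<close>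

lemma taylor_integral2:
  fixes g :: "real \<Rightarrow> 'a::banach"
  assumes g1: "\<And>x. x \<in> {0..l} \<Longrightarrow> (g has_vector_derivative g1 x) (at x within {0..l})"
    and g2: "\<And>x. x \<in> {0..l} \<Longrightarrow> (g1 has_vector_derivative g2 x) (at x within {0..l})"
    and "g 0 = 0" "g1 0 = 0" and x: "x \<in> {0..l}"
  shows "((\<lambda>y. (x - y) *\<^sub>R g2 y) has_integral g x) {0..x}"
proof -
  have "((\<lambda>y. (x - y) *\<^sub>R g2 y) has_integral
      (((x - x) *\<^sub>R g1 x + g x) - ((x - 0) *\<^sub>R g1 0 + g 0))) {0..x}"
  proof (rule fundamental_theorem_of_calculus)
    fix y assume y: "y \<in> {0..x}"
    have sub: "y \<in> {0..l}" "{0..x} \<subseteq> {0..l}" using x y by auto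
    note d1 = has_vector_derivative_within_subset[OF g1[OF sub(1)] sub(2)]
    note d2 = has_vector_derivative_within_subset[OF g2[OF sub(1)] sub(2)]
    have "((\<lambda>y. x - y) has_real_derivative - 1) (at y within {0..x})"
      by (auto intro!: derivative_eq_intros)
    from has_vector_derivative_add[OF has_vector_derivative_scaleR[OF this d2] d1]
    show "((\<lambda>y. (x - y) *\<^sub>R g1 y + g y) has_vector_derivative (x - y) *\<^sub>R g2 y) (at y within {0..x})"
      by simp
  qed (use x in auto)
  then show ?thesis using assms by simp
qed

text \<open>The second derivative is reflected, frozen beyond \<open>l\<close> and integrated twice
  from 0, so nothing has to be glued at 0 or \<open>l\<close>. The condition \<open>F1 0 = 0\<close>
  is what makes the first integral agree with \<open>F1\<close>, and so the reflection twice
  differentiable at 0.\<close>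

lemma even_extension:
  fixes F :: "real \<Rightarrow> 'a::euclidean_space"
  assumes "l \<ge> 0"
    and F1: "\<And>x. x \<in> {0..l} \<Longrightarrow> (F has_vector_derivative F1 x) (at x within {0..l})"
    and F2: "\<And>x. x \<in> {0..l} \<Longrightarrow> (F1 has_vector_derivative F2 x) (at x within {0..l})"
    and cont: "continuous_on {0..l} F2" and "F1 0 = 0"
  obtains f f1 f2 where "\<And>y. (f has_vector_derivative f1 y) (at y)"
    "\<And>y. (f1 has_vector_derivative f2 y) (at y)" "continuous_on UNIV f2"
    "\<And>y. \<bar>y\<bar> \<le> l \<Longrightarrow> f y = F \<bar>y\<bar>" "\<And>y. \<bar>y\<bar> \<le> l \<Longrightarrow> f2 y = F2 \<bar>y\<bar>" "f1 0 = 0"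
proof -
  define f2 where "f2 y = F2 (min \<bar>y\<bar> l)" for y
  define f where "f y = F 0 + prim (prim f2) y" for y
  have cf2: "continuous_on UNIV f2"
    unfolding f2_def by (rule continuous_on_compose2[OF cont]) (use \<open>l \<ge> 0\<close> in \<open>auto intro!: continuous_intros\<close>)
  have cf1: "continuous_on UNIV (prim f2)" by (rule continuous_on_prim[OF cf2])
  have f1: "(f has_vector_derivative prim f2 y) (at y)" for y
    unfolding f_def using has_vector_derivative_add[OF has_vector_derivative_const prim_has_vector_derivative[OF cf1]]
    by simp
  have sub: "(G has_vector_derivative d) (at z within {0..y})"
    if "(G has_vector_derivative d) (at z within {0..l})" "y \<in> {0..l}" for G :: "real \<Rightarrow> 'a" and d z y
    by (rule has_vector_derivative_within_subset[OF that(1)]) (use that in auto)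
  have 1: "prim f2 y = F1 y" if y: "y \<in> {0..l}" for y
  proof -
    have "(F1 has_vector_derivative f2 z) (at z within {0..y})" if "z \<in> {0..y}" for z
      using sub[OF F2 y, of z] that y by (simp add: f2_def)
    then show ?thesis using prim_eqI[of y F1 f2] y \<open>F1 0 = 0\<close> by simp
  qed
  have 2: "f y = F y" if y: "y \<in> {0..l}" for y
  proof -
    have "(F has_vector_derivative prim f2 z) (at z within {0..y})" if "z \<in> {0..y}" for z
      using sub[OF F1 y, of z] that y by (simp add: 1)
    then show ?thesis using prim_eqI[of y F "prim f2"] y by (simp add: f_def)
  qed
  have "(\<lambda>y. f2 (- y)) = f2" by (rule ext) (simp add: f2_def)
  then have "prim f2 (- z) = - prim f2 z" for z
    by (simp add: prim_minus)
  then have 3: "f (- y) = f y" for y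
    using prim_bounded_linear[OF bounded_linear_minus[OF bounded_linear_ident] cf1, of y]
    by (simp add: f_def prim_minus)
  show thesis
  proof (rule that[OF f1 prim_has_vector_derivative[OF cf2] cf2])
    show "f y = F \<bar>y\<bar>" if "\<bar>y\<bar> \<le> l" for y
      using 2[of "\<bar>y\<bar>"] 3[of y] that by (cases "y \<ge> 0") auto
    show "f2 y = F2 \<bar>y\<bar>" if "\<bar>y\<bar> \<le> l" for y using that by (simp add: f2_def)
  qed simp
qed

section \<open>Factorial estimates\<close>

lemma fact_mult_power_le: "fact n * n ^ k \<le> (fact (n + k) :: nat)"
proof (induction k)
  case (Suc k)
  have "fact n * n ^ Suc k = n * (fact n * n ^ k)" by simp
  also have "\<dots> \<le> (n + Suc k) * fact (n + k)" using Suc by (intro mult_mono) auto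
  finally show ?case by simp
qed simp

text \<open>The balance of the test-function argument: \<open>n ^ n\<close> is the cost of n time
  derivatives, \<open>fact (2 * n)\<close> the gain of 2n integrations in x, and a full
  \<open>fact n\<close> is left over.\<close>

lemma power_div_fact_le: "real n ^ n / fact (2 * n) \<le> 1 / fact n"
proof -
  have "real (fact n * n ^ n) \<le> real (fact (2 * n))"
    using fact_mult_power_le[of n n] by (simp only: of_nat_le_iff mult_2)
  then show ?thesis by (simp add: field_simps)
qed

lemma power_over_fact_contradiction:
  fixes \<epsilon> c A D :: real
  assumes "\<epsilon> > 0" "c > 0" and le: "\<And>n::nat. \<epsilon> * c ^ n \<le> A * D ^ n / fact n"
  shows False
proof -
  have "\<epsilon> \<le> A * ((D / c) ^ n / fact n)" for n
    using le[of n] \<open>c > 0\<close> by (simp add: power_divide field_simps)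
  moreover have "(\<lambda>n. A * ((D / c) ^ n / fact n)) \<longlonglongrightarrow> A * 0"
    by (intro tendsto_mult tendsto_const)
      (use summable_LIMSEQ_zero[OF summable_exp[of "D / c"]] in \<open>simp add: field_simps\<close>)
  ultimately have "\<epsilon> \<le> A * 0" by (intro LIMSEQ_le_const) auto
  then show False using \<open>\<epsilon> > 0\<close> by simp
qed

text \<open>Taylor's formula applied to \<open>y ^ (k + 2) / fact (k + 2)\<close>: one double
  integration raises the power by two.\<close>

lemma integral_power_kernel:
  fixes x :: real assumes "x \<ge> 0"
  shows "((\<lambda>y. (x - y) * (y ^ k / fact k)) has_integral x ^ (k + 2) / fact (k + 2)) {0..x}"
proof -
  have d: "((\<lambda>y. y ^ Suc m / fact (Suc m)) has_vector_derivative y ^ m / fact m) (at y within S)"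
    for m and y :: real and S
  proof -
    have "((\<lambda>y::real. y ^ Suc m / fact (Suc m)) has_real_derivative real (Suc m) * y ^ m / fact (Suc m)) (at y within S)"
      by (rule derivative_eq_intros | simp)+
    moreover have "real (Suc m) * y ^ m / fact (Suc m) = y ^ m / fact m"
      unfolding fact_Suc by simp
    ultimately show ?thesis by (simp only: has_real_derivative_iff_has_vector_derivative)
  qed
  have "((\<lambda>y. (x - y) *\<^sub>R (y ^ k / fact k)) has_integral x ^ Suc (Suc k) / fact (Suc (Suc k))) {0..x}"
    by (rule taylor_integral2[where l = x, OF d d]) (use assms in auto)
  then show ?thesis by (simp only: real_scaleR_def add_2_eq_Suc')
qed

text \<open>
  Unique continuation from \<open>x = 0\<close> for \<open>J w\<^sub>t = w\<^sub>x\<^sub>x - Q w\<close>. Testing with \<open>(t - a) ^ i * (b - t) ^ j\<close> and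
  trading each time derivative for a double integral in \<open>x\<close> gives, for \<open>i = j = n\<close>, a bound of order
  \<open>n ^ n / fact (2 * n)\<close>, which is smaller than any geometric sequence.
\<close>

locale cauchy_zero =
  fixes l a b q \<sigma> A :: real and Q :: "real \<Rightarrow> 'a::euclidean_space \<Rightarrow>\<^sub>L 'a" and J :: "'a \<Rightarrow>\<^sub>L 'a"
    and w wt :: "real \<Rightarrow> real \<Rightarrow> 'a"
  assumes ab: "a \<le> b" "b - a \<le> 1" and l: "l \<ge> 0"
    and cont_Q: "continuous_on {0..l} Q"
    and cont_w: "continuous_on ({a..b} \<times> {0..l}) (\<lambda>(t, x). w t x)"
    and cont_wt: "continuous_on ({a..b} \<times> {0..l}) (\<lambda>(t, x). wt t x)"
    and w_t: "\<And>t x. t \<in> {a..b} \<Longrightarrow> x \<in> {0..l} \<Longrightarrow> ((\<lambda>t. w t x) has_vector_derivative wt t x) (at t within {a..b})"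
    and eq: "\<And>t x. t \<in> {a..b} \<Longrightarrow> x \<in> {0..l} \<Longrightarrow>
      w t x = integral {0..x} (\<lambda>y. (x - y) *\<^sub>R (blinfun_apply (Q y) (w t y) + blinfun_apply J (wt t y)))"
    and q: "q \<ge> 0" "\<And>x. x \<in> {0..l} \<Longrightarrow> norm (Q x) \<le> q" and \<sigma>: "norm J \<le> \<sigma>"
    and A: "A \<ge> 0" "\<And>t x. t \<in> {a..b} \<Longrightarrow> x \<in> {0..l} \<Longrightarrow> norm (w t x) \<le> A"
begin

text \<open>Differentiation lowers one of the exponents, so two indices keep the family closed, up
  to factors \<open>i\<close> and \<open>j\<close>. Since \<open>b - a\<close> is at most 1, the
  weights stay below 1 for all exponents.\<close>

definition \<phi> :: "nat \<Rightarrow> nat \<Rightarrow> real \<Rightarrow> real" where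
  "\<phi> i j t = (t - a) ^ i * (b - t) ^ j"

definition W :: "nat \<Rightarrow> nat \<Rightarrow> real \<Rightarrow> 'a" where
  "W i j x = integral {a..b} (\<lambda>t. \<phi> i j t *\<^sub>R w t x)"

lemma \<phi>_bounds: "t \<in> {a..b} \<Longrightarrow> 0 \<le> \<phi> i j t \<and> \<phi> i j t \<le> 1"
  unfolding \<phi>_def using ab by (auto intro!: mult_nonneg_nonneg mult_le_one power_le_one)

lemma continuous_on_\<phi> [continuous_intros]: "continuous_on S g \<Longrightarrow> continuous_on S (\<lambda>p. \<phi> i j (g p))"
  unfolding \<phi>_def by (intro continuous_intros)

lemma cont_w_section: "x \<in> {0..l} \<Longrightarrow> continuous_on {a..b} (\<lambda>t. w t x)"
  and cont_wt_section: "x \<in> {0..l} \<Longrightarrow> continuous_on {a..b} (\<lambda>t. wt t x)"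
  using continuous_on_section_fst[OF cont_w] continuous_on_section_fst[OF cont_wt] by auto

lemma int_\<phi>w: "x \<in> {0..l} \<Longrightarrow> (\<lambda>t. \<phi> i j t *\<^sub>R w t x) integrable_on {a..b}"
  by (intro integrable_continuous_real continuous_intros cont_w_section)

lemma continuous_on_W: "continuous_on {0..l} (W i j)"
proof -
  have "continuous_on ({0..l} \<times> cbox a b) (\<lambda>(x, t). \<phi> i j t *\<^sub>R w t x)"
    unfolding split_beta
    by (intro continuous_intros continuous_on_compose2[OF cont_w[unfolded split_beta], of _ "\<lambda>p. (snd p, fst p)", simplified]) auto
  from integral_continuous_on_param[OF this] show ?thesis by (simp add: W_def[abs_def])
qed

lemma norm_W_le: assumes "x \<in> {0..l}" shows "norm (W i j x) \<le> A"
proof -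
  have "norm (W i j x) \<le> A * (b - a)"
    unfolding W_def
  proof (rule integral_bound[OF ab(1)])
    show "continuous_on {a..b} (\<lambda>t. \<phi> i j t *\<^sub>R w t x)"
      by (intro continuous_intros cont_w_section assms)
    show "norm (\<phi> i j t *\<^sub>R w t x) \<le> A" if "t \<in> {a..b}" for t
      using mult_mono[OF conjunct2[OF \<phi>_bounds[OF that, of i j]] A(2)[OF that assms]] \<phi>_bounds[OF that, of i j]
      by simp
  qed
  also have "\<dots> \<le> A * 1" using A ab by (intro mult_left_mono) auto
  finally show ?thesis by simp
qed

lemma W_by_parts:
  assumes x: "x \<in> {0..l}"
  shows "integral {a..b} (\<lambda>t. \<phi> (Suc i) (Suc j) t *\<^sub>R wt t x)
    = real (Suc j) *\<^sub>R W (Suc i) j x - real (Suc i) *\<^sub>R W i (Suc j) x"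
proof -
  let ?d = "\<lambda>t. real (Suc i) * \<phi> i (Suc j) t - real (Suc j) * \<phi> (Suc i) j t"
  have d: "(\<phi> (Suc i) (Suc j) has_real_derivative ?d t) (at t within S)" for t S
    unfolding \<phi>_def by (rule derivative_eq_intros refl | simp)+
  have "((\<lambda>t. \<phi> (Suc i) (Suc j) t *\<^sub>R wt t x + ?d t *\<^sub>R w t x) has_integral
      (\<phi> (Suc i) (Suc j) b *\<^sub>R w b x - \<phi> (Suc i) (Suc j) a *\<^sub>R w a x)) {a..b}"
    by (rule fundamental_theorem_of_calculus[OF ab(1)])
      (intro has_vector_derivative_scaleR d w_t x)
  \<comment> \<open>Both exponents are positive, so the weight vanishes at \<open>a\<close> and at
    \<open>b\<close>.\<close>
  then have 1: "integral {a..b} (\<lambda>t. \<phi> (Suc i) (Suc j) t *\<^sub>R wt t x + ?d t *\<^sub>R w t x) = 0"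
    by (simp add: integral_unique \<phi>_def)
  have 2: "integral {a..b} (\<lambda>t. \<phi> (Suc i) (Suc j) t *\<^sub>R wt t x + ?d t *\<^sub>R w t x)
      = integral {a..b} (\<lambda>t. \<phi> (Suc i) (Suc j) t *\<^sub>R wt t x) + integral {a..b} (\<lambda>t. ?d t *\<^sub>R w t x)"
    by (rule integral_add)
      (intro integrable_continuous_real continuous_intros cont_w_section cont_wt_section x)+
  have 3: "integral {a..b} (\<lambda>t. ?d t *\<^sub>R w t x) = real (Suc i) *\<^sub>R W i (Suc j) x - real (Suc j) *\<^sub>R W (Suc i) j x"
  proof -
    have "integral {a..b} (\<lambda>t. ?d t *\<^sub>R w t x)
        = integral {a..b} (\<lambda>t. real (Suc i) *\<^sub>R (\<phi> i (Suc j) t *\<^sub>R w t x) - real (Suc j) *\<^sub>R (\<phi> (Suc i) j t *\<^sub>R w t x))"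
      by (simp only: scaleR_diff_left scaleR_scaleR)
    also have "\<dots> = integral {a..b} (\<lambda>t. real (Suc i) *\<^sub>R (\<phi> i (Suc j) t *\<^sub>R w t x))
        - integral {a..b} (\<lambda>t. real (Suc j) *\<^sub>R (\<phi> (Suc i) j t *\<^sub>R w t x))"
      by (rule integral_diff) (intro integrable_cmul int_\<phi>w x)+
    finally show ?thesis by (simp only: integral_cmul W_def)
  qed
  show ?thesis
    using 1[unfolded 2 3] by (simp only: eq_neg_iff_add_eq_0[symmetric] minus_diff_eq)
qed

text \<open>The integral equation is multiplied by the weight and integrated in t, with the
  integrals exchanged. Each use moves a single time derivative to the weight; iterating on
  \<open>W\<close> replaces the higher derivatives which \<open>w\<close> need not have.\<close>

lemma W_eq:
  assumes x: "x \<in> {0..l}"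
  shows "W (Suc i) (Suc j) x = integral {0..x} (\<lambda>y. (x - y) *\<^sub>R (blinfun_apply (Q y) (W (Suc i) (Suc j) y)
    + blinfun_apply J (real (Suc j) *\<^sub>R W (Suc i) j y - real (Suc i) *\<^sub>R W i (Suc j) y)))"
proof -
  let ?\<phi> = "\<phi> (Suc i) (Suc j)"
  let ?r = "\<lambda>t y. blinfun_apply (Q y) (w t y) + blinfun_apply J (wt t y)"
  have "W (Suc i) (Suc j) x = integral {a..b} (\<lambda>t. ?\<phi> t *\<^sub>R integral {0..x} (\<lambda>y. (x - y) *\<^sub>R ?r t y))"
    unfolding W_def by (rule integral_cong) (simp add: eq[OF _ x])
  also have "\<dots> = integral (cbox a b) (\<lambda>t. integral (cbox 0 x) (\<lambda>y. ?\<phi> t *\<^sub>R (x - y) *\<^sub>R ?r t y))"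
    unfolding interval_cbox by (simp only: integral_cmul)
  also have "\<dots> = integral (cbox 0 x) (\<lambda>y. integral (cbox a b) (\<lambda>t. ?\<phi> t *\<^sub>R (x - y) *\<^sub>R ?r t y))"
  proof (rule integral_swap_continuous)
    have cw: "continuous_on (cbox (a, 0) (b, x)) (\<lambda>p. w (fst p) (snd p))"
      "continuous_on (cbox (a, 0) (b, x)) (\<lambda>p. wt (fst p) (snd p))"
      by (rule continuous_on_subset[OF cont_w[unfolded split_beta]]
          continuous_on_subset[OF cont_wt[unfolded split_beta]], use x in \<open>auto simp: cbox_Pair_eq\<close>)+
    have cq: "continuous_on (cbox (a, 0) (b, x)) (\<lambda>p. Q (snd p))"
      by (rule continuous_on_compose2[OF cont_Q]) (use x in \<open>auto simp: cbox_Pair_eq intro!: continuous_intros\<close>)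
    show "continuous_on (cbox (a, 0) (b, x)) (\<lambda>(t, y). ?\<phi> t *\<^sub>R (x - y) *\<^sub>R ?r t y)"
      unfolding split_beta by (intro continuous_intros cw cq)
  qed
  also have "\<dots> = integral {0..x} (\<lambda>y. (x - y) *\<^sub>R (blinfun_apply (Q y) (W (Suc i) (Suc j) y)
    + blinfun_apply J (real (Suc j) *\<^sub>R W (Suc i) j y - real (Suc i) *\<^sub>R W i (Suc j) y)))"
    unfolding interval_cbox[symmetric]
  proof (rule integral_cong)
    fix y assume "y \<in> {0..x}"
    then have y: "y \<in> {0..l}" using x by auto
    have int_t: "(\<lambda>t. ?\<phi> t *\<^sub>R wt t y) integrable_on {a..b}"
      by (intro integrable_continuous_real continuous_intros cont_wt_section y)
    have "integral {a..b} (\<lambda>t. ?\<phi> t *\<^sub>R (x - y) *\<^sub>R ?r t y)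
        = (x - y) *\<^sub>R integral {a..b} (\<lambda>t. blinfun_apply (Q y) (?\<phi> t *\<^sub>R w t y) + blinfun_apply J (?\<phi> t *\<^sub>R wt t y))"
      by (simp add: integral_cmul[symmetric] blinfun.scaleR_right scaleR_add_right mult.commute del: integral_cmul)
    also have "integral {a..b} (\<lambda>t. blinfun_apply (Q y) (?\<phi> t *\<^sub>R w t y) + blinfun_apply J (?\<phi> t *\<^sub>R wt t y))
        = integral {a..b} (\<lambda>t. blinfun_apply (Q y) (?\<phi> t *\<^sub>R w t y)) + integral {a..b} (\<lambda>t. blinfun_apply J (?\<phi> t *\<^sub>R wt t y))"
      by (rule integral_add)
        (intro integrable_continuous_real continuous_intros cont_w_section cont_wt_section y)+
    also have "\<dots> = blinfun_apply (Q y) (W (Suc i) (Suc j) y) + blinfun_apply J (integral {a..b} (\<lambda>t. ?\<phi> t *\<^sub>R wt t y))"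
      using integral_linear[OF int_\<phi>w[OF y, of "Suc i" "Suc j"] blinfun.bounded_linear_right[of "Q y"]]
        integral_linear[OF int_t blinfun.bounded_linear_right[of J]]
      by (simp add: o_def W_def)
    finally show "integral {a..b} (\<lambda>t. ?\<phi> t *\<^sub>R (x - y) *\<^sub>R ?r t y)
        = (x - y) *\<^sub>R (blinfun_apply (Q y) (W (Suc i) (Suc j) y)
          + blinfun_apply J (real (Suc j) *\<^sub>R W (Suc i) j y - real (Suc i) *\<^sub>R W i (Suc j) y))"
      by (simp only: W_by_parts[OF y])
  qed
  finally show ?thesis .
qed

text \<open>The price of one iteration, apart from a factor \<open>n\<close>:
  \<open>2 * \<sigma>\<close> for the two terms of the differentiated weight under \<open>J\<close>,
  and the exponential for absorbing \<open>Q\<close> by \<open>gronwall\<close>.\<close>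

definition C :: real where "C = 2 * \<sigma> * exp (q * l * l)"

lemma \<sigma>_nonneg: "0 \<le> \<sigma>" by (rule order_trans[OF norm_ge_zero \<sigma>])

text \<open>One iteration lowers one of the exponents by 1, costs \<open>C * n\<close> and raises
  the power of x by two. The number \<open>n\<close> bounds all exponents met on the way and stays
  fixed, and \<open>m\<close> iterations are possible as long as both exponents are at least
  \<open>m\<close>.\<close>

lemma W_bound:
  assumes "m \<le> i" "m \<le> j" "i \<le> n" "j \<le> n" "x \<in> {0..l}"
  shows "norm (W i j x) \<le> A * (C * n) ^ m * (x ^ (2 * m) / fact (2 * m))"
  using assms
proof (induction m arbitrary: i j x)
  case 0
  then show ?case using norm_W_le by simp
next
  case (Suc m)
  then obtain i' j' where ij: "i = Suc i'" "j = Suc j'" by (metis Suc_le_D)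
  define B where "B = A * (C * n) ^ m"
  have B: "B \<ge> 0" using A \<sigma>_nonneg by (simp add: B_def C_def)
  define c where "c = 2 * \<sigma> * n * B"
  have c: "c \<ge> 0" using B \<sigma>_nonneg by (simp add: c_def)
  \<comment> \<open>Taken at the end point x, so that it is constant on \<open>{0..x}\<close>, as
    \<open>gronwall\<close> requires.\<close>
  define M where "M = c * (x ^ (2 * m + 2) / fact (2 * m + 2))"
  have M: "norm (W i j z) \<le> M + q * l * integral {0..z} (\<lambda>y. norm (W i j y))" if z: "z \<in> {0..x}" for z
  proof -
    have zl: "z \<in> {0..l}" using z Suc.prems by auto
    let ?r = "\<lambda>y. (z - y) *\<^sub>R (blinfun_apply (Q y) (W i j y)
      + blinfun_apply J (real j *\<^sub>R W i j' y - real i *\<^sub>R W i' j y))"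
    have hi: "((\<lambda>y. c * ((z - y) * (y ^ (2 * m) / fact (2 * m)))) has_integral c * (z ^ (2 * m + 2) / fact (2 * m + 2))) {0..z}"
      by (rule has_integral_mult_right[OF integral_power_kernel]) (use z in auto)
    have cW: "continuous_on {0..z} (W i j)" for i j
      by (rule continuous_on_subset[OF continuous_on_W]) (use zl in auto)
    have cQ: "continuous_on {0..z} Q"
      by (rule continuous_on_subset[OF cont_Q]) (use zl in auto)
    have int1: "(\<lambda>y. q * l * norm (W i j y)) integrable_on {0..z}"
      by (intro integrable_continuous_real continuous_intros cW)
    have "norm (W i j z) = norm (integral {0..z} ?r)"
      using W_eq[OF zl, of i' j'] by (simp only: ij)
    also have "\<dots> \<le> integral {0..z} (\<lambda>y. q * l * norm (W i j y) + c * ((z - y) * (y ^ (2 * m) / fact (2 * m))))"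
    proof (rule integral_norm_bound_integral)
      show "?r integrable_on {0..z}"
        by (intro integrable_continuous_real continuous_intros cW cQ)
      show "(\<lambda>y. q * l * norm (W i j y) + c * ((z - y) * (y ^ (2 * m) / fact (2 * m)))) integrable_on {0..z}"
        using hi by (intro integrable_add int1) auto
      fix y assume y: "y \<in> {0..z}"
      then have yl: "y \<in> {0..l}" using zl by auto
      define b0 where "b0 = B * (y ^ (2 * m) / fact (2 * m))"
      have b1: "norm (W i j' y) \<le> b0" "norm (W i' j y) \<le> b0"
        unfolding b0_def B_def using Suc.prems ij yl by (intro Suc.IH; simp)+
      have b0: "b0 \<ge> 0" using order_trans[OF norm_ge_zero b1(1)] .
      have "norm (real j *\<^sub>R W i j' y - real i *\<^sub>R W i' j y) \<le> norm (real j *\<^sub>R W i j' y) + norm (real i *\<^sub>R W i' j y)"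
        by (rule norm_triangle_ineq4)
      also have "\<dots> \<le> real n * b0 + real n * b0"
        unfolding norm_scaleR using b1 Suc.prems by (intro add_mono mult_mono) auto
      finally have n1: "norm (real j *\<^sub>R W i j' y - real i *\<^sub>R W i' j y) \<le> 2 * n * b0" by (simp add: mult_ac)
      have n2: "norm (blinfun_apply J (real j *\<^sub>R W i j' y - real i *\<^sub>R W i' j y)) \<le> \<sigma> * (2 * n * b0)"
        by (rule order_trans[OF norm_blinfun]) (intro mult_mono \<sigma> n1 \<sigma>_nonneg norm_ge_zero)
      have n3: "norm (blinfun_apply (Q y) (W i j y)) \<le> q * norm (W i j y)"
        by (rule order_trans[OF norm_blinfun]) (intro mult_right_mono q yl norm_ge_zero)
      have "norm (?r y) \<le> (z - y) * (q * norm (W i j y) + \<sigma> * (2 * n * b0))"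
        unfolding norm_scaleR using y n2 n3
        by (intro mult_mono norm_triangle_le add_mono) auto
      also have "\<dots> = (z - y) * (q * norm (W i j y)) + c * ((z - y) * (y ^ (2 * m) / fact (2 * m)))"
        by (simp add: c_def b0_def algebra_simps)
      \<comment> \<open>In the term to be absorbed the kernel is simply bounded by \<open>l\<close>.
        In the source it is kept, since it produces the two additional powers.\<close>
      also have "(z - y) * (q * norm (W i j y)) \<le> l * (q * norm (W i j y))"
        using y yl zl q by (intro mult_right_mono) auto
      finally show "norm (?r y) \<le> q * l * norm (W i j y) + c * ((z - y) * (y ^ (2 * m) / fact (2 * m)))"
        by (simp add: mult_ac)
    qed
    also have "\<dots> = integral {0..z} (\<lambda>y. q * l * norm (W i j y))
        + integral {0..z} (\<lambda>y. c * ((z - y) * (y ^ (2 * m) / fact (2 * m))))"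
      by (rule integral_add[OF int1 has_integral_integrable[OF hi]])
    also have "\<dots> = q * l * integral {0..z} (\<lambda>y. norm (W i j y)) + c * (z ^ (2 * m + 2) / fact (2 * m + 2))"
      unfolding integral_unique[OF hi] by simp
    also have "c * (z ^ (2 * m + 2) / fact (2 * m + 2)) \<le> M"
      unfolding M_def using z c by (intro mult_left_mono divide_right_mono power_mono) auto
    finally show ?thesis by simp
  qed
  have x: "x \<ge> 0" "x \<le> l" using Suc.prems by auto
  have M0: "M \<ge> 0" using c x by (simp add: M_def)
  have "continuous_on {0..x} (\<lambda>y. norm (W i j y))"
    using Suc.prems by (intro continuous_intros continuous_on_subset[OF continuous_on_W]) auto
  from gronwall[OF this _ M, of x] have "norm (W i j x) \<le> M * exp (q * l * x)"
    using x q l by auto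
  also have "\<dots> \<le> M * exp (q * l * l)"
    using x q l M0 by (intro mult_left_mono) (auto intro!: mult_left_mono)
  also have "\<dots> = A * (C * n) ^ Suc m * (x ^ (2 * Suc m) / fact (2 * Suc m))"
    by (simp add: M_def c_def B_def C_def)
  finally show ?case .
qed

lemma W_diag_bound: "x \<in> {0..l} \<Longrightarrow> norm (W n n x) \<le> A * (C * x\<^sup>2) ^ n / fact n"
proof -
  assume x: "x \<in> {0..l}"
  have "norm (W n n x) \<le> A * (C * n) ^ n * (x ^ (2 * n) / fact (2 * n))"
    by (rule W_bound) (use x in auto)
  also have "\<dots> = A * (C * x\<^sup>2) ^ n * (real n ^ n / fact (2 * n))"
    by (simp add: power_mult_distrib power_mult)
  also have "\<dots> \<le> A * (C * x\<^sup>2) ^ n * (1 / fact n)"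
    using A \<sigma>_nonneg by (intro mult_left_mono power_div_fact_le) (auto simp: C_def)
  finally show ?thesis by simp
qed

end

text \<open>If \<open>w\<close> is nonzero at a point, its component along that value stays positive
  for t nearby, so testing with the nonnegative weights gives a lower bound that is geometric in n.
  The upper bound \<open>W_diag_bound\<close> has a factorial in the denominator and eventually
  falls below it.\<close>

lemma sideways_unique:
  fixes w wt :: "real \<Rightarrow> real \<Rightarrow> 'a::euclidean_space" and Q :: "real \<Rightarrow> 'a \<Rightarrow>\<^sub>L 'a" and J :: "'a \<Rightarrow>\<^sub>L 'a"
  assumes l: "l \<ge> 0" and cont_Q: "continuous_on {0..l} Q"
    and cont_w: "continuous_on ({0..T} \<times> {0..l}) (\<lambda>(t, x). w t x)"
    and cont_wt: "continuous_on ({0..T} \<times> {0..l}) (\<lambda>(t, x). wt t x)"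
    and w_t: "\<And>t x. t \<in> {0..T} \<Longrightarrow> x \<in> {0..l} \<Longrightarrow> ((\<lambda>t. w t x) has_vector_derivative wt t x) (at t within {0..T})"
    and eq: "\<And>t x. t \<in> {0<..<T} \<Longrightarrow> x \<in> {0..l} \<Longrightarrow>
      w t x = integral {0..x} (\<lambda>y. (x - y) *\<^sub>R (blinfun_apply (Q y) (w t y) + blinfun_apply J (wt t y)))"
    and t0: "t0 \<in> {0<..<T}" and x0: "x0 \<in> {0..l}"
  shows "w t0 x0 = 0"
proof (rule ccontr)
  assume "w t0 x0 \<noteq> 0"
  define e where "e = w t0 x0"
  \<comment> \<open>Half of the value at \<open>t0\<close>, which continuity preserves on a
    neighbourhood.\<close>
  define \<epsilon> where "\<epsilon> = (e \<bullet> e) / 2"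
  have \<epsilon>: "\<epsilon> > 0" "\<epsilon> < w t0 x0 \<bullet> e" using \<open>w t0 x0 \<noteq> 0\<close> by (auto simp: \<epsilon>_def e_def)
  have "continuous_on {0..T} (\<lambda>t. w t x0 \<bullet> e)"
    by (intro continuous_intros continuous_on_section_fst[OF cont_w x0])
  then have "continuous_on {0<..<T} (\<lambda>t. w t x0 \<bullet> e)"
    by (rule continuous_on_subset) auto
  then have "open ({0<..<T} \<inter> (\<lambda>t. w t x0 \<bullet> e) -` {\<epsilon><..})"
    by (intro continuous_open_preimage) auto
  moreover have "t0 \<in> {0<..<T} \<inter> (\<lambda>t. w t x0 \<bullet> e) -` {\<epsilon><..}" using t0 \<epsilon> by auto
  ultimately obtain d where d: "d > 0" "cball t0 d \<subseteq> {0<..<T} \<inter> (\<lambda>t. w t x0 \<bullet> e) -` {\<epsilon><..}"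
    by (meson open_contains_cball)
  \<comment> \<open>The cap 1/2 ensures \<open>b - a \<le> 1\<close>, as demanded by
    \<open>cauchy_zero\<close>.\<close>
  define \<delta> where "\<delta> = min d (1 / 2)"
  have \<delta>: "\<delta> > 0" "\<delta> \<le> 1 / 2" using d by (auto simp: \<delta>_def)
  define a where "a = t0 - \<delta>"
  define b where "b = t0 + \<delta>"
  have sub: "t \<in> {0<..<T} \<and> \<epsilon> \<le> w t x0 \<bullet> e" if "t \<in> {a..b}" for t
  proof -
    have "t \<in> cball t0 d" using that by (auto simp: a_def b_def \<delta>_def dist_real_def)
    then show ?thesis using d by force
  qed
  have sub': "{a..b} \<subseteq> {0..T}" using sub by force
  have "bounded (Q ` {0..l})" by (intro compact_imp_bounded compact_continuous_image cont_Q) auto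
  then obtain q where q: "\<forall>z\<in>Q ` {0..l}. norm z \<le> q" by (auto simp: bounded_iff)
  have "bounded ((\<lambda>(t, x). w t x) ` ({0..T} \<times> {0..l}))"
    by (intro compact_imp_bounded compact_continuous_image cont_w compact_Times) auto
  then obtain A where A: "\<forall>z\<in>(\<lambda>(t, x). w t x) ` ({0..T} \<times> {0..l}). norm z \<le> A" by (auto simp: bounded_iff)
  interpret cauchy_zero l a b q "norm J" A Q J w wt
  proof
    show "a \<le> b" "b - a \<le> 1" using \<delta> by (auto simp: a_def b_def)
    show "continuous_on ({a..b} \<times> {0..l}) (\<lambda>(t, x). w t x)"
      by (rule continuous_on_subset[OF cont_w]) (use sub' in auto)
    show "continuous_on ({a..b} \<times> {0..l}) (\<lambda>(t, x). wt t x)"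
      by (rule continuous_on_subset[OF cont_wt]) (use sub' in auto)
    show "((\<lambda>t. w t x) has_vector_derivative wt t x) (at t within {a..b})" if "t \<in> {a..b}" "x \<in> {0..l}" for t x
      by (rule has_vector_derivative_within_subset[OF w_t]) (use that sub' in auto)
    show "q \<ge> 0" "\<And>x. x \<in> {0..l} \<Longrightarrow> norm (Q x) \<le> q" using q l order_trans[OF norm_ge_zero] by fastforce+
    show "A \<ge> 0" using A t0 x0 order_trans[OF norm_ge_zero] by fastforce
    show "norm (w t x) \<le> A" if "t \<in> {a..b}" "x \<in> {0..l}" for t x using A that sub' by auto
  qed (use l cont_Q eq sub in auto)
  have lower: "\<epsilon> * \<delta> * (3 / 4 * \<delta>\<^sup>2) ^ n \<le> norm e * A * (C * x0\<^sup>2) ^ n / fact n" for n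
  proof -
    let ?c = "(3 / 4 * \<delta>\<^sup>2) ^ n"
    let ?I = "{t0 - \<delta> / 2..t0 + \<delta> / 2}"
    have I: "?I \<subseteq> {a..b}" using \<delta> by (auto simp: a_def b_def)
    have hi: "((\<lambda>t. \<epsilon> * ?c) has_integral \<epsilon> * ?c * \<delta>) ?I"
      using has_integral_const_real[of "\<epsilon> * ?c" "t0 - \<delta> / 2" "t0 + \<delta> / 2"] \<delta> by (simp add: mult_ac)
    have int: "(\<lambda>t. (\<phi> n n t *\<^sub>R w t x0) \<bullet> e) integrable_on S" if "S = {a..b} \<or> S = ?I" for S
    proof -
      have "continuous_on {a..b} (\<lambda>t. (\<phi> n n t *\<^sub>R w t x0) \<bullet> e)"
        by (intro continuous_intros cont_w_section x0)
      then show ?thesis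
        using that I integrable_continuous_real continuous_on_subset by metis
    qed
    have "\<epsilon> * ?c * \<delta> \<le> integral ?I (\<lambda>t. (\<phi> n n t *\<^sub>R w t x0) \<bullet> e)"
    proof (rule has_integral_le[OF hi integrable_integral[OF int]])
      fix t assume t: "t \<in> ?I"
      have tab: "t \<in> {a..b}" using t I by auto
      have "\<bar>t - t0\<bar> \<le> \<delta> / 2" using t unfolding atLeastAtMost_iff by linarith
      then have "\<bar>t - t0\<bar>\<^sup>2 \<le> (\<delta> / 2)\<^sup>2" by (rule power_mono) simp
      \<comment> \<open>The product equals \<open>\<delta>\<^sup>2 - (t - t0)\<^sup>2\<close>, and
        on the middle half of \<open>{a..b}\<close> the subtracted square is at most a quarter of
        the first.\<close>
      then have "3 / 4 * \<delta>\<^sup>2 \<le> (t - a) * (b - t)"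
        by (simp add: a_def b_def power2_eq_square algebra_simps)
      then have "?c \<le> ((t - a) * (b - t)) ^ n" by (rule power_mono) simp
      then have "?c \<le> \<phi> n n t" by (simp add: \<phi>_def power_mult_distrib)
      then have "?c * \<epsilon> \<le> \<phi> n n t * (w t x0 \<bullet> e)"
        using sub[OF tab] \<epsilon> \<phi>_bounds[OF tab] by (intro mult_mono) auto
      then show "\<epsilon> * ?c \<le> (\<phi> n n t *\<^sub>R w t x0) \<bullet> e" by (simp add: mult.commute)
    qed simp
    also have "\<dots> \<le> integral {a..b} (\<lambda>t. (\<phi> n n t *\<^sub>R w t x0) \<bullet> e)"
    proof (rule integral_subset_le[OF I int int])
      show "\<forall>t\<in>{a..b}. 0 \<le> (\<phi> n n t *\<^sub>R w t x0) \<bullet> e"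
      proof
        fix t assume t: "t \<in> {a..b}"
        show "0 \<le> (\<phi> n n t *\<^sub>R w t x0) \<bullet> e"
          using sub[OF t] \<epsilon> \<phi>_bounds[OF t, of n n] by auto
      qed
    qed auto
    also have "\<dots> = W n n x0 \<bullet> e"
      using integral_linear[OF int_\<phi>w[OF x0] bounded_linear_inner_left[of e]] by (simp add: o_def W_def)
    also have "\<dots> \<le> norm (W n n x0) * norm e" by (rule norm_cauchy_schwarz)
    also have "\<dots> \<le> (A * (C * x0\<^sup>2) ^ n / fact n) * norm e"
      by (intro mult_right_mono W_diag_bound x0) auto
    finally show ?thesis by (simp add: mult_ac)
  qed
  show False
    by (rule power_over_fact_contradiction[OF _ _ lower]) (use \<epsilon> \<delta> in auto)
qed

section \<open>Comparison of the two systems\<close>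

text \<open>The derivatives are named functions here, so that the calculus rules apply directly to
  vector-valued solutions, without the choice hidden in \<open>vector_derivative\<close>.\<close>

definition C12_derivs :: "real \<Rightarrow> real \<Rightarrow> (real \<Rightarrow> real \<Rightarrow> 'a::real_normed_vector) \<Rightarrow>
    (real \<Rightarrow> real \<Rightarrow> 'a) \<Rightarrow> (real \<Rightarrow> real \<Rightarrow> 'a) \<Rightarrow> (real \<Rightarrow> real \<Rightarrow> 'a) \<Rightarrow> bool" where
  "C12_derivs T l u ut ux uxx \<longleftrightarrow>
    (\<forall>t\<in>{0..T}. \<forall>x\<in>{0..l}.
      ((\<lambda>t. u t x) has_vector_derivative ut t x) (at t within {0..T}) \<and>
      (u t has_vector_derivative ux t x) (at x within {0..l}) \<and>
      (ux t has_vector_derivative uxx t x) (at x within {0..l})) \<and>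
    continuous_on ({0..T} \<times> {0..l}) (\<lambda>(t, x). u t x) \<and>
    continuous_on ({0..T} \<times> {0..l}) (\<lambda>(t, x). ut t x) \<and>
    continuous_on ({0..T} \<times> {0..l}) (\<lambda>(t, x). ux t x) \<and>
    continuous_on ({0..T} \<times> {0..l}) (\<lambda>(t, x). uxx t x)"

text \<open>Carries data given on open intervals to the end points, in particular to the times 0 and
  T where the spatial data may be placed.\<close>

lemma zero_on_Icc_if_zero_on_interior:
  fixes f :: "real \<Rightarrow> 'a::real_normed_vector"
  assumes "continuous_on {a..b} f" "\<And>x. x \<in> {a<..<b} \<Longrightarrow> f x = 0" "a < b" "x \<in> {a..b}"
  shows "f x = 0"
  using continuous_constant_on_closure[of "{a<..<b}" f 0 x] assms by simp

text \<open>\<open>J\<close> is multiplication by \<open>\<sigma>\<close> seen as a real-linear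
  operator. Evenness of \<open>P\<close> makes \<open>f'' - P f\<close> even whenever
  \<open>f\<close> is, so that it is again a reflected function.\<close>

locale transmutation_J = transmutation l P Q for l and P Q :: "real \<Rightarrow> 'a::euclidean_space \<Rightarrow>\<^sub>L 'a" +
  fixes J :: "'a \<Rightarrow>\<^sub>L 'a" and T :: real
  assumes even_P: "\<And>y. P (- y) = P y"
    and JP: "\<And>y. J o\<^sub>L P y = P y o\<^sub>L J" and JQ: "\<And>y. J o\<^sub>L Q y = Q y o\<^sub>L J" and T: "T > 0"
begin

definition reflect :: "(real \<Rightarrow> 'a) \<Rightarrow> real \<Rightarrow> 'a" where
  "reflect f y = f (min \<bar>y\<bar> l)"

lemma continuous_on_reflect: "continuous_on {0..l} f \<Longrightarrow> continuous_on S (reflect f)"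
  unfolding reflect_def using l_nonneg by (auto intro!: continuous_intros continuous_on_compose2[of "{0..l}" f])

lemma continuous_on_reflect2:
  assumes "continuous_on (R \<times> {0..l}) (\<lambda>(t, x). f t x)"
  shows "continuous_on (R \<times> S) (\<lambda>(t, y). reflect (f t) y)"
proof -
  have "continuous_on (R \<times> S) (\<lambda>p. (\<lambda>(t, x). f t x) (fst p, min \<bar>snd p\<bar> l))"
    by (rule continuous_on_compose2[OF assms]) (use l_nonneg in \<open>auto intro!: continuous_intros\<close>)
  then show ?thesis by (simp add: reflect_def split_beta)
qed

text \<open>The boundary condition lets \<open>u t\<close> extend to an even \<open>f\<close> that
  is twice differentiable. The equation identifies \<open>f'' - P f\<close> on
  \<open>{-l..l}\<close> with \<open>J\<close> applied to the reflected \<open>ut t\<close>, the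
  intertwining relation supplies the second derivative, and \<open>K_commute\<close> pulls
  \<open>J\<close> out of \<open>K x\<close>.\<close>

lemma transmuted_solution:
  assumes u: "C12_derivs T l u ut ux uxx"
    and u_eq: "\<And>t x. t \<in> {0..T} \<Longrightarrow> x \<in> {0..l} \<Longrightarrow>
      blinfun_apply J (ut t x) = uxx t x - blinfun_apply (P x) (u t x)"
    and t: "t \<in> {0..T}" and bc: "ux t 0 = 0"
  obtains h1 where "h1 0 = 0"
    and "\<forall>x\<in>{0..l}. ((\<lambda>x. u t x + blinfun_apply (K x) (clamped l (reflect (u t)))) has_vector_derivative h1 x) (at x within {0..l})"
    and "\<forall>x\<in>{0..l}. (h1 has_vector_derivative
      blinfun_apply (Q x) (u t x + blinfun_apply (K x) (clamped l (reflect (u t))))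
        + blinfun_apply J (ut t x + blinfun_apply (K x) (clamped l (reflect (ut t))))) (at x within {0..l})"
proof -
  have cut: "continuous_on {0..l} (ut t)" and cuxx: "continuous_on {0..l} (uxx t)"
    using u t continuous_on_section_snd unfolding C12_derivs_def by metis+
  obtain f f1 f2 where f1: "\<And>y. (f has_vector_derivative f1 y) (at y)"
    and f2: "\<And>y. (f1 has_vector_derivative f2 y) (at y)" and cf2: "continuous_on UNIV f2"
    and f: "\<And>y. \<bar>y\<bar> \<le> l \<Longrightarrow> f y = u t \<bar>y\<bar>" and f2_eq: "\<And>y. \<bar>y\<bar> \<le> l \<Longrightarrow> f2 y = uxx t \<bar>y\<bar>" and "f1 0 = 0"
    by (rule even_extension[OF l_nonneg, of "u t" "ux t" "uxx t"])
      (use u t bc cuxx in \<open>auto simp: C12_derivs_def\<close>)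
  have clf: "clamped l f = clamped l (reflect (u t))"
    by (rule clamped_cong[OF l_nonneg]) (auto simp: f reflect_def)
  have P_abs: "P y = P \<bar>y\<bar>" for y by (simp add: abs_if even_P)
  have J: "f2 y - blinfun_apply (P y) (f y) = blinfun_apply J (ut t \<bar>y\<bar>)" if "\<bar>y\<bar> \<le> l" for y
    using that t by (simp add: f f2_eq P_abs[of y] u_eq)
  have "clamped l (\<lambda>y. f2 y - blinfun_apply (P y) (f y)) = clamped l (\<lambda>y. blinfun_apply J (reflect (ut t) y))"
    by (rule clamped_cong[OF l_nonneg]) (simp add: J reflect_def)
  then have KJ: "blinfun_apply (K x) (clamped l (\<lambda>y. f2 y - blinfun_apply (P y) (f y)))
      = blinfun_apply J (blinfun_apply (K x) (clamped l (reflect (ut t))))" if "x \<in> {0..l}" for x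
    using K_commute[OF JP JQ that continuous_on_reflect[OF cut]] by simp
  obtain h1 where h1: "h1 0 = f1 0"
    "\<forall>x\<in>{0..l}. ((\<lambda>x. f x + blinfun_apply (K x) (clamped l f)) has_vector_derivative h1 x) (at x within {0..l})"
    "\<forall>x\<in>{0..l}. (h1 has_vector_derivative
      blinfun_apply (Q x) (f x + blinfun_apply (K x) (clamped l f)) + (f2 x - blinfun_apply (P x) (f x))
        + blinfun_apply (K x) (clamped l (\<lambda>y. f2 y - blinfun_apply (P y) (f y)))) (at x within {0..l})"
    by (rule transmutation_derivatives[OF f1 f2 cf2]) (rule that; assumption)
  have fx: "f y = u t y" if "y \<in> {0..l}" for y using f[of y] that by auto
  show thesis
  proof (rule that)
    show "h1 0 = 0" using h1(1) \<open>f1 0 = 0\<close> by simp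
    show "\<forall>x\<in>{0..l}. ((\<lambda>x. u t x + blinfun_apply (K x) (clamped l (reflect (u t)))) has_vector_derivative h1 x) (at x within {0..l})"
    proof
      fix x assume x: "x \<in> {0..l}"
      show "((\<lambda>x. u t x + blinfun_apply (K x) (clamped l (reflect (u t)))) has_vector_derivative h1 x) (at x within {0..l})"
        by (rule has_vector_derivative_transform[OF x _ bspec[OF h1(2) x]]) (simp add: fx clf)
    qed
    show "\<forall>x\<in>{0..l}. (h1 has_vector_derivative
      blinfun_apply (Q x) (u t x + blinfun_apply (K x) (clamped l (reflect (u t))))
        + blinfun_apply J (ut t x + blinfun_apply (K x) (clamped l (reflect (ut t))))) (at x within {0..l})"
    proof
      fix x assume x: "x \<in> {0..l}"
      show "(h1 has_vector_derivative
        blinfun_apply (Q x) (u t x + blinfun_apply (K x) (clamped l (reflect (u t))))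
          + blinfun_apply J (ut t x + blinfun_apply (K x) (clamped l (reflect (ut t))))) (at x within {0..l})"
        using bspec[OF h1(3) x] J[of x] x by (simp add: fx clf KJ[OF x] blinfun.add_right add.assoc)
    qed
  qed
qed

lemma continuous_on_K_reflect:
  assumes "continuous_on ({0..T} \<times> {0..l}) (\<lambda>(t, x). f t x)"
  shows "continuous_on ({0..T} \<times> {0..l}) (\<lambda>(t, x). blinfun_apply (K x) (clamped l (reflect (f t))))"
proof -
  have "continuous_on {0..T} (\<lambda>t. clamped l (reflect (f t)))"
    by (intro continuous_on_clamped l_nonneg continuous_on_reflect2 assms)
  then have "continuous_on ({0..T} \<times> {0..l}) (\<lambda>p. clamped l (reflect (f (fst p))))"
    by (rule continuous_on_compose2) (auto intro!: continuous_intros)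
  moreover have "continuous_on ({0..T} \<times> {0..l}) (\<lambda>p. K (snd p))"
    by (rule continuous_on_compose2[OF continuous_on_K]) (auto intro!: continuous_intros)
  ultimately show ?thesis unfolding split_beta by (intro continuous_intros)
qed

text \<open>The difference \<open>w\<close> of the two sides solves the system with
  \<open>Q\<close>. Its Cauchy data at \<open>x = 0\<close> vanish: the value because
  \<open>K 0 = 0\<close> and the boundary traces agree, the x-derivative because both Neumann
  conditions hold and \<open>h1 0 = 0\<close>.\<close>

lemma transmuted_eq:
  assumes u: "C12_derivs T l u ut ux uxx" and v: "C12_derivs T l v vt vx vxx"
    and u_eq: "\<And>t x. t \<in> {0..T} \<Longrightarrow> x \<in> {0..l} \<Longrightarrow>
      blinfun_apply J (ut t x) = uxx t x - blinfun_apply (P x) (u t x)"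
    and v_eq: "\<And>t x. t \<in> {0..T} \<Longrightarrow> x \<in> {0..l} \<Longrightarrow>
      blinfun_apply J (vt t x) = vxx t x - blinfun_apply (Q x) (v t x)"
    and u_bc: "\<And>t. t \<in> {0<..<T} \<Longrightarrow> ux t 0 = 0" and v_bc: "\<And>t. t \<in> {0<..<T} \<Longrightarrow> vx t 0 = 0"
    and uv: "\<And>t. t \<in> {0<..<T} \<Longrightarrow> u t 0 = v t 0"
    and t: "t \<in> {0..T}" and x: "x \<in> {0..l}"
  shows "v t x = u t x + blinfun_apply (K x) (clamped l (reflect (u t)))"
proof -
  note U = u[unfolded C12_derivs_def] and V = v[unfolded C12_derivs_def]
  define w where "w t x = u t x + blinfun_apply (K x) (clamped l (reflect (u t))) - v t x" for t x
  define wt where "wt t x = ut t x + blinfun_apply (K x) (clamped l (reflect (ut t))) - vt t x" for t x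
  have cu: "continuous_on ({0..T} \<times> {0..l}) (\<lambda>(t, x). u t x)" "continuous_on ({0..T} \<times> {0..l}) (\<lambda>(t, x). ut t x)"
    and cv: "continuous_on ({0..T} \<times> {0..l}) (\<lambda>(t, x). v t x)" "continuous_on ({0..T} \<times> {0..l}) (\<lambda>(t, x). vt t x)"
    using U V by blast+
  have cont_w: "continuous_on ({0..T} \<times> {0..l}) (\<lambda>(t, x). w t x)"
    using cu(1) cv(1) continuous_on_K_reflect[OF cu(1)]
    unfolding w_def split_beta by (intro continuous_on_add continuous_on_diff)
  have cont_wt: "continuous_on ({0..T} \<times> {0..l}) (\<lambda>(t, x). wt t x)"
    using cu(2) cv(2) continuous_on_K_reflect[OF cu(2)]
    unfolding wt_def split_beta by (intro continuous_on_add continuous_on_diff)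
  have w_t: "((\<lambda>t. w t x) has_vector_derivative wt t x) (at t within {0..T})"
    if "t \<in> {0..T}" "x \<in> {0..l}" for t x
  proof -
    have "((\<lambda>t. clamped l (reflect (u t))) has_vector_derivative clamped l (reflect (ut t))) (at t within {0..T})"
    proof (rule clamped_has_vector_derivative[OF l_nonneg])
      show "((\<lambda>s. reflect (u s) y) has_vector_derivative reflect (ut s) y) (at s within {0..T})"
        if "s \<in> {0..T}" for s y
        unfolding reflect_def using U that l_nonneg by auto
    qed (use U that in \<open>auto intro!: continuous_on_reflect2\<close>)
    then show ?thesis
      unfolding w_def wt_def using U V that
      by (intro has_vector_derivative_add has_vector_derivative_diff
          bounded_linear.has_vector_derivative[OF blinfun.bounded_linear_right]) auto
  qed
  have w_eq: "w t x = integral {0..x} (\<lambda>y. (x - y) *\<^sub>R (blinfun_apply (Q y) (w t y) + blinfun_apply J (wt t y)))"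
    if t: "t \<in> {0<..<T}" and x: "x \<in> {0..l}" for t x
  proof -
    have t': "t \<in> {0..T}" using t by auto
    obtain h1 where h1: "h1 0 = 0"
      "\<forall>x\<in>{0..l}. ((\<lambda>x. u t x + blinfun_apply (K x) (clamped l (reflect (u t)))) has_vector_derivative h1 x) (at x within {0..l})"
      "\<forall>x\<in>{0..l}. (h1 has_vector_derivative
        blinfun_apply (Q x) (u t x + blinfun_apply (K x) (clamped l (reflect (u t))))
          + blinfun_apply J (ut t x + blinfun_apply (K x) (clamped l (reflect (ut t))))) (at x within {0..l})"
      by (rule transmuted_solution[OF u _ t' u_bc[OF t]]) (rule u_eq that; assumption)+
    have "((\<lambda>y. (x - y) *\<^sub>R (blinfun_apply (Q y) (w t y) + blinfun_apply J (wt t y))) has_integral w t x) {0..x}"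
    proof (rule taylor_integral2[where l = l and g = "w t" and ?g1.0 = "\<lambda>x. h1 x - vx t x", OF _ _ _ _ x])
      fix y assume y: "y \<in> {0..l}"
      show "(w t has_vector_derivative h1 y - vx t y) (at y within {0..l})"
        unfolding w_def using V t' y by (intro has_vector_derivative_diff h1(2)[rule_format] h1(3)[rule_format]) auto
      have "((\<lambda>x. h1 x - vx t x) has_vector_derivative
        (blinfun_apply (Q y) (u t y + blinfun_apply (K y) (clamped l (reflect (u t))))
          + blinfun_apply J (ut t y + blinfun_apply (K y) (clamped l (reflect (ut t))))) - vxx t y) (at y within {0..l})"
        using V t' y by (intro has_vector_derivative_diff h1(2)[rule_format] h1(3)[rule_format]) auto
      moreover have "vxx t y = blinfun_apply J (vt t y) + blinfun_apply (Q y) (v t y)"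
        using v_eq[OF t' y] by simp
      ultimately show "((\<lambda>x. h1 x - vx t x) has_vector_derivative
          blinfun_apply (Q y) (w t y) + blinfun_apply J (wt t y)) (at y within {0..l})"
        by (simp add: w_def wt_def blinfun.diff_right algebra_simps)
    qed (use h1(1) uv[OF t] v_bc[OF t] in \<open>auto simp: w_def K_0\<close>)
    then show ?thesis by (simp add: integral_unique)
  qed
  \<comment> \<open>The data are known only for t strictly between 0 and T; continuity in t then
    adds both end points.\<close>
  have "w t x = 0"
  proof (rule zero_on_Icc_if_zero_on_interior[OF continuous_on_section_fst[OF cont_w x] _ T t])
    show "w s x = 0" if "s \<in> {0<..<T}" for s
      by (rule sideways_unique[OF l_nonneg continuous_on_subset[OF cont_Q] cont_w cont_wt w_t w_eq that x]) auto
  qed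
  then show ?thesis by (simp add: w_def)
qed

text \<open>At \<open>\<tau>\<close> the transmuted solution coincides with \<open>u \<tau>\<close>,
  so its second x-derivative can be read off in two ways: as \<open>uxx \<tau>\<close>, given by the
  equation with \<open>P\<close>, and by the intertwining, given with \<open>Q\<close>. Their
  difference is the claim.\<close>

lemma coefficient_difference:
  assumes u: "C12_derivs T l u ut ux uxx" and v: "C12_derivs T l v vt vx vxx"
    and u_eq: "\<And>t x. t \<in> {0..T} \<Longrightarrow> x \<in> {0..l} \<Longrightarrow>
      blinfun_apply J (ut t x) = uxx t x - blinfun_apply (P x) (u t x)"
    and v_eq: "\<And>t x. t \<in> {0..T} \<Longrightarrow> x \<in> {0..l} \<Longrightarrow>
      blinfun_apply J (vt t x) = vxx t x - blinfun_apply (Q x) (v t x)"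
    and u_bc: "\<And>t. t \<in> {0<..<T} \<Longrightarrow> ux t 0 = 0" and v_bc: "\<And>t. t \<in> {0<..<T} \<Longrightarrow> vx t 0 = 0"
    and uv: "\<And>t. t \<in> {0<..<T} \<Longrightarrow> u t 0 = v t 0"
    and \<tau>: "\<tau> \<in> {0..T}" and uv\<tau>: "\<And>x. x \<in> {0<..<l} \<Longrightarrow> u \<tau> x = v \<tau> x"
    and x: "x \<in> {0..l}"
  shows "blinfun_apply (Q x - P x) (u \<tau> x) = - blinfun_apply J (blinfun_apply (K x) (clamped l (reflect (ut \<tau>))))"
proof -
  note U = u[unfolded C12_derivs_def] and V = v[unfolded C12_derivs_def]
  \<comment> \<open>\<open>\<tau>\<close> may be 0 or T, outside the open interval of the boundary
    condition.\<close>
  have "ux \<tau> 0 = 0"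
  proof (rule zero_on_Icc_if_zero_on_interior[OF _ u_bc T \<tau>])
    show "continuous_on {0..T} (\<lambda>t. ux t 0)" using U continuous_on_section_fst[of "{0..T}" "{0..l}" ux 0] l_nonneg by auto
  qed
  have "u \<tau> y - v \<tau> y = 0" if "y \<in> {0..l}" for y
  proof (rule zero_on_Icc_if_zero_on_interior[OF _ _ l_pos that])
    show "continuous_on {0..l} (\<lambda>y. u \<tau> y - v \<tau> y)"
      using U V \<tau> continuous_on_section_snd[of "{0..T}" "{0..l}" u \<tau>] continuous_on_section_snd[of "{0..T}" "{0..l}" v \<tau>]
      by (auto intro!: continuous_intros)
  qed (use uv\<tau> in auto)
  then have K0: "blinfun_apply (K y) (clamped l (reflect (u \<tau>))) = 0" if "y \<in> {0..l}" for y
    using transmuted_eq[OF u v u_eq v_eq u_bc v_bc uv \<tau> that] that by simp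
  obtain h1 where "h1 0 = 0" and h1:
    "\<forall>x\<in>{0..l}. ((\<lambda>x. u \<tau> x + blinfun_apply (K x) (clamped l (reflect (u \<tau>)))) has_vector_derivative h1 x) (at x within {0..l})"
    "\<forall>x\<in>{0..l}. (h1 has_vector_derivative
      blinfun_apply (Q x) (u \<tau> x + blinfun_apply (K x) (clamped l (reflect (u \<tau>))))
        + blinfun_apply J (ut \<tau> x + blinfun_apply (K x) (clamped l (reflect (ut \<tau>))))) (at x within {0..l})"
    by (rule transmuted_solution[OF u _ \<tau> \<open>ux \<tau> 0 = 0\<close>]) (rule u_eq that; assumption)+
  have uniq: "d = d'" if "(g has_vector_derivative d) (at y within {0..l})"
      "(g has_vector_derivative d') (at y within {0..l})" "y \<in> {0..l}" for g :: "real \<Rightarrow> 'a" and d d' y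
    using vector_derivative_unique_within_closed_interval[of 0 l y g d d'] l_pos that by auto
  have "h1 y = ux \<tau> y" if y: "y \<in> {0..l}" for y
  proof (rule uniq[OF _ _ y])
    show "(u \<tau> has_vector_derivative h1 y) (at y within {0..l})"
      by (rule has_vector_derivative_transform[OF y _ bspec[OF h1(1) y]]) (simp add: K0)
    show "(u \<tau> has_vector_derivative ux \<tau> y) (at y within {0..l})" using U \<tau> y by auto
  qed
  then have "(h1 has_vector_derivative uxx \<tau> x) (at x within {0..l})"
    using U \<tau> x by (intro has_vector_derivative_transform[OF x, of h1 "ux \<tau>"]) auto
  from uniq[OF this bspec[OF h1(2) x] x]
  have "uxx \<tau> x = blinfun_apply (Q x) (u \<tau> x) + blinfun_apply J (ut \<tau> x) + blinfun_apply J (blinfun_apply (K x) (clamped l (reflect (ut \<tau>))))"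
    by (simp add: K0[OF x] blinfun.add_right add.assoc)
  then show ?thesis using u_eq[OF \<tau> x] by (simp add: blinfun.diff_left algebra_simps)
qed

lemma coefficients_eq:
  assumes le: "\<And>x. x \<in> {0..l} \<Longrightarrow> norm (Q x - P x) \<le> c * norm (K x)" and x: "x \<in> {0..l}"
  shows "Q x = P x"
proof -
  obtain c' where c': "c' \<ge> 0"
    "\<forall>x\<in>{0..l}. norm (K x) \<le> integral {0..x} (\<lambda>s. c' * (norm (Q s - P s) + norm (K s)))"
    using norm_K_le by auto
  have cK: "continuous_on {0..l} (\<lambda>s. norm (K s))" by (intro continuous_intros continuous_on_K)
  have "norm (K x) \<le> 0 * exp (c' * (\<bar>c\<bar> + 1) * x)"
  proof (rule gronwall[OF cK _ _ x])
    show "0 \<le> c' * (\<bar>c\<bar> + 1)" using c' by simp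
    fix z assume z: "z \<in> {0..l}"
    have sub: "{0..z} \<subseteq> {0..l}" using z by auto
    have "norm (K z) \<le> integral {0..z} (\<lambda>s. c' * (norm (Q s - P s) + norm (K s)))" using c' z by auto
    also have "\<dots> \<le> integral {0..z} (\<lambda>s. c' * (\<bar>c\<bar> + 1) * norm (K s))"
    proof (rule integral_le)
      show "(\<lambda>s. c' * (norm (Q s - P s) + norm (K s))) integrable_on {0..z}"
        by (intro integrable_continuous_real continuous_intros continuous_on_subset[OF cont_P]
            continuous_on_subset[OF cont_Q] continuous_on_subset[OF continuous_on_K sub]) auto
      show "(\<lambda>s. c' * (\<bar>c\<bar> + 1) * norm (K s)) integrable_on {0..z}"
        by (intro integrable_continuous_real continuous_intros continuous_on_subset[OF continuous_on_K sub])
      fix s assume s: "s \<in> {0..z}"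
      have "norm (Q s - P s) \<le> c * norm (K s)" using le s sub by auto
      also have "\<dots> \<le> \<bar>c\<bar> * norm (K s)" by (intro mult_right_mono) auto
      finally have "c' * (norm (Q s - P s) + norm (K s)) \<le> c' * (\<bar>c\<bar> * norm (K s) + norm (K s))"
        using c' by (intro mult_left_mono) auto
      then show "c' * (norm (Q s - P s) + norm (K s)) \<le> c' * (\<bar>c\<bar> + 1) * norm (K s)"
        by (simp add: algebra_simps)
    qed
    finally show "norm (K z) \<le> 0 + c' * (\<bar>c\<bar> + 1) * integral {0..z} (\<lambda>s. norm (K s))" by simp
  qed
  then have "norm (Q x - P x) \<le> 0" using le[OF x] by simp
  then show ?thesis by simp
qed

end

section \<open>Components of complex vectors and matrices as operators\<close>

lemma has_vector_derivative_vec: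
  fixes f :: "real \<Rightarrow> 'a::real_normed_vector ^ 'n"
  assumes "\<And>i. ((\<lambda>x. f x $ i) has_vector_derivative d i) (at x within S)"
  shows "(f has_vector_derivative (\<chi> i. d i)) (at x within S)"
  unfolding has_vector_derivative_def has_derivative_within
proof (intro conjI bounded_linear_scaleR_left vec_tendstoI)
  fix i
  show "((\<lambda>y. ((1 / norm (y - x)) *\<^sub>R (f y - (f x + (y - x) *\<^sub>R (\<chi> i. d i)))) $ i) \<longlongrightarrow> 0 $ i) (at x within S)"
    using assms[of i] by (simp add: has_vector_derivative_def has_derivative_within)
qed

text \<open>Regularity is assumed for the components, while the equations contain derivatives of the
  vectors. The two agree because derivatives within an interval of positive length are
  unique.\<close>

lemma C12_derivs_vec:
  fixes u :: "real \<Rightarrow> real \<Rightarrow> complex ^ 'n"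
  assumes "l > 0" "T > 0" and C12: "\<And>i. C12_rectangle T l (\<lambda>t x. u t x $ i)"
  shows "C12_derivs T l u (partial_t T u) (partial_x l u) (partial_x l (partial_x l u))"
proof -
  let ?c = "\<lambda>i t x. u t x $ i"
  note C = C12[unfolded C12_rectangle_def]
  have cell: "((\<lambda>s. u s x) has_vector_derivative (\<chi> i. partial_t T (?c i) t x)) (at t within {0..T})"
    "(u t has_vector_derivative (\<chi> i. partial_x l (?c i) t x)) (at x within {0..l})"
    if "t \<in> {0..T}" "x \<in> {0..l}" for t x
    by (rule has_vector_derivative_vec; use C that in \<open>auto simp: partial_t_def partial_x_def vector_derivative_works[symmetric]\<close>)+
  have pt: "partial_t T u t x = (\<chi> i. partial_t T (?c i) t x)"
    and px: "partial_x l u t x = (\<chi> i. partial_x l (?c i) t x)" if "t \<in> {0..T}" "x \<in> {0..l}" for t x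
    unfolding partial_t_def[of T u] partial_x_def[of l u]
    by (rule vector_derivative_within_closed_interval; use assms cell[OF that] that in simp)+
  have d2: "(partial_x l u t has_vector_derivative (\<chi> i. partial_x l (partial_x l (?c i)) t x)) (at x within {0..l})"
    if tx: "t \<in> {0..T}" "x \<in> {0..l}" for t x
  proof (rule has_vector_derivative_vec)
    fix i
    have "(partial_x l (?c i) t has_vector_derivative partial_x l (partial_x l (?c i)) t x) (at x within {0..l})"
      using C tx unfolding partial_x_def[of l "partial_x l (?c i)"] vector_derivative_works[symmetric] by blast
    then show "((\<lambda>y. partial_x l u t y $ i) has_vector_derivative partial_x l (partial_x l (?c i)) t x) (at x within {0..l})"
      by (rule has_vector_derivative_transform[OF tx(2), rotated]) (subst px[OF tx(1)], simp_all)
  qed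
  have pxx: "partial_x l (partial_x l u) t x = (\<chi> i. partial_x l (partial_x l (?c i)) t x)"
    if "t \<in> {0..T}" "x \<in> {0..l}" for t x
    unfolding partial_x_def[of l "partial_x l u"]
    by (rule vector_derivative_within_closed_interval; use assms d2[OF that] that in simp)
  have cont: "continuous_on ({0..T} \<times> {0..l}) (\<lambda>(t, x). g t x)"
    if "\<And>i. continuous_on ({0..T} \<times> {0..l}) (\<lambda>(t, x). h i t x)"
      "\<And>t x. t \<in> {0..T} \<Longrightarrow> x \<in> {0..l} \<Longrightarrow> g t x = (\<chi> i. h i t x)" for g :: "real \<Rightarrow> real \<Rightarrow> complex ^ 'n" and h
  proof -
    have "continuous_on ({0..T} \<times> {0..l}) (\<lambda>p. \<chi> i. h i (fst p) (snd p))"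
      using that(1) by (intro continuous_on_vec_lambda) (simp add: split_beta)
    then show ?thesis by (rule continuous_on_eq) (auto simp: that(2))
  qed
  show ?thesis
    unfolding C12_derivs_def
  proof (intro conjI ballI)
    show "continuous_on ({0..T} \<times> {0..l}) (\<lambda>(t, x). u t x)"
      by (rule cont[of ?c]) (use C in auto)
    show "continuous_on ({0..T} \<times> {0..l}) (\<lambda>(t, x). partial_t T u t x)"
      by (rule cont[OF _ pt]) (use C in auto)
    show "continuous_on ({0..T} \<times> {0..l}) (\<lambda>(t, x). partial_x l u t x)"
      by (rule cont[OF _ px]) (use C in auto)
    show "continuous_on ({0..T} \<times> {0..l}) (\<lambda>(t, x). partial_x l (partial_x l u) t x)"
      by (rule cont[OF _ pxx]) (use C in auto)
  qed (use cell d2 pt px pxx in auto)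
qed

definition mv :: "complex ^ 'n ^ 'n \<Rightarrow> (complex ^ 'n) \<Rightarrow>\<^sub>L (complex ^ 'n)" where
  "mv A = Blinfun ((*v) A)"

lemma mv_apply [simp]: "blinfun_apply (mv A) z = A *v z"
  unfolding mv_def by (simp add: bounded_linear_Blinfun_apply)

lemma bounded_linear_mv: "bounded_linear mv"
proof -
  have "linear mv"
  proof (rule linearI)
    show "mv (A + B) = mv A + mv B" for A B :: "complex ^ 'n ^ 'n"
      by (rule blinfun_eqI) (simp add: blinfun.add_left matrix_vector_mult_add_rdistrib)
    show "mv (r *\<^sub>R A) = r *\<^sub>R mv A" for r and A :: "complex ^ 'n ^ 'n"
      by (rule blinfun_eqI)
        (simp add: blinfun.scaleR_left vec_eq_iff matrix_vector_mult_def scaleR_sum_right)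
  qed
  then show ?thesis by (simp add: linear_conv_bounded_linear)
qed

lemma mv_diff: "mv A - mv B = mv (A - B)"
  using linear_diff[OF bounded_linear.linear[OF bounded_linear_mv]] by metis

text \<open>A matrix annihilating all columns of an invertible matrix is zero, so the sum is
  positive for \<open>A\<close> on the unit sphere. Compactness of interval times sphere turns this
  into a positive minimum, and \<open>c\<close> is its reciprocal by homogeneity in
  \<open>A\<close>.\<close>

lemma columns_bound:
  fixes U :: "real \<Rightarrow> 'n::finite \<Rightarrow> complex ^ 'n"
  assumes "l \<ge> 0" and cont: "\<And>k. continuous_on {0..l} (\<lambda>x. U x k)"
    and det: "\<And>x. x \<in> {0..l} \<Longrightarrow> det (matrix_of_columns (U x)) \<noteq> 0"
  obtains c where "c \<ge> 0" "\<And>x (A :: complex ^ 'n ^ 'n). x \<in> {0..l} \<Longrightarrow> norm A \<le> c * (\<Sum>k\<in>UNIV. norm (A *v U x k))"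
proof -
  define F where "F p = (\<Sum>k\<in>UNIV. norm (snd p *v U (fst p) k))" for p :: "real \<times> (complex ^ 'n ^ 'n)"
  let ?S = "{0..l} \<times> sphere (0 :: complex ^ 'n ^ 'n) 1"
  have "compact ?S" by (intro compact_Times compact_Icc compact_sphere)
  moreover have "?S \<noteq> {}" using \<open>l \<ge> 0\<close> by simp
  moreover have "continuous_on ?S F"
  proof -
    have 1: "continuous_on ?S (\<lambda>p. mv (snd p))"
      by (rule bounded_linear.continuous_on[OF bounded_linear_mv]) (intro continuous_intros)
    have 2: "continuous_on ?S (\<lambda>p. U (fst p) k)" for k
      by (rule continuous_on_compose2[OF cont]) (auto intro!: continuous_intros)
    have "continuous_on ?S (\<lambda>p. \<Sum>k\<in>UNIV. norm (blinfun_apply (mv (snd p)) (U (fst p) k)))"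
      by (intro continuous_intros 1 2)
    then show ?thesis by (simp add: F_def[abs_def])
  qed
  ultimately obtain p where p: "p \<in> ?S" and min: "\<And>p'. p' \<in> ?S \<Longrightarrow> F p \<le> F p'"
    using continuous_attains_inf[of ?S F] by blast
  have "F p \<noteq> 0"
  proof
    assume "F p = 0"
    then have "snd p *v U (fst p) k = 0" for k
      by (simp add: F_def sum_nonneg_eq_0_iff)
    then have 0: "(\<Sum>j\<in>UNIV. snd p $ i $ j * U (fst p) k $ j) = 0" for i k
      by (simp add: vec_eq_iff matrix_vector_mult_def)
    have *: "snd p ** matrix_of_columns (U (fst p)) = 0"
      by (simp add: vec_eq_iff matrix_matrix_mult_def matrix_of_columns_def 0)
    have "invertible (matrix_of_columns (U (fst p)))"
      using det p by (auto simp: invertible_det_nz)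
    then obtain M where "matrix_of_columns (U (fst p)) ** M = mat 1" by (auto simp: invertible_def)
    then have "snd p = snd p ** matrix_of_columns (U (fst p)) ** M"
      by (simp add: matrix_mul_assoc[symmetric])
    also have "\<dots> = 0" unfolding * by (simp add: vec_eq_iff matrix_matrix_mult_def)
    finally show False using p by auto
  qed
  then have pos: "F p > 0" by (simp add: F_def sum_nonneg order_le_neq_trans)
  show thesis
  proof
    show "0 \<le> 1 / F p" using pos by simp
    fix x and A :: "complex ^ 'n ^ 'n" assume x: "x \<in> {0..l}"
    show "norm A \<le> 1 / F p * (\<Sum>k\<in>UNIV. norm (A *v U x k))"
    proof (cases "A = 0")
      case False
      have "F p \<le> F (x, (1 / norm A) *\<^sub>R A)" using x False by (intro min) simp
      also have "\<dots> = (\<Sum>k\<in>UNIV. 1 / norm A * norm (A *v U x k))"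
      proof -
        have "((1 / norm A) *\<^sub>R A) *v z = (1 / norm A) *\<^sub>R (A *v z)" for z
          by (simp add: vec_eq_iff matrix_vector_mult_def scaleR_sum_right)
        then show ?thesis by (simp add: F_def)
      qed
      also have "\<dots> = 1 / norm A * (\<Sum>k\<in>UNIV. norm (A *v U x k))" by (simp only: sum_distrib_left)
      finally show ?thesis using pos False by (simp add: field_simps)
    qed (use pos in \<open>auto intro!: mult_nonneg_nonneg sum_nonneg\<close>)
  qed
qed

lemma continuous_on_matrix_C1:
  fixes R :: "real \<Rightarrow> complex ^ 'n ^ 'n"
  assumes "\<And>i j. C1_interval l (\<lambda>x. R x $ i $ j)"
  shows "continuous_on {0..l} R"
proof -
  have "continuous_on {0..l} (\<lambda>x. R x $ i $ j)" for i j
    using assms[of i j] differentiable_imp_continuous_within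
    unfolding C1_interval_def continuous_on_eq_continuous_within by blast
  then have "continuous_on {0..l} (\<lambda>x. \<chi> i j. R x $ i $ j)"
    by (intro continuous_on_vec_lambda)
  then show ?thesis by (simp add: vec_lambda_eta)
qed

text \<open>The continuation runs in x, so the direction of time is immaterial and one argument
  covers every \<open>\<tau>\<close> in \<open>{0..T}\<close>; the two cases are its ends.\<close>

lemma coefficients_determined:
  fixes l T \<tau> :: real and \<sigma> :: complex
    and P Q :: "real \<Rightarrow> complex ^ 'n ^ 'n"
    and u v :: "'n::finite \<Rightarrow> real \<Rightarrow> real \<Rightarrow> complex ^ 'n"
  assumes "l > 0" and "T > 0" and \<tau>: "\<tau> \<in> {0..T}"
    and P_C1: "\<And>i j. C1_interval l (\<lambda>x. P x $ i $ j)"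
    and Q_C1: "\<And>i j. C1_interval l (\<lambda>x. Q x $ i $ j)"
    and u_C12: "\<And>k i. C12_rectangle T l (\<lambda>t x. u k t x $ i)"
    and v_C12: "\<And>k i. C12_rectangle T l (\<lambda>t x. v k t x $ i)"
    and u_eq: "\<And>k t x. t \<in> {0..T} \<Longrightarrow> x \<in> {0..l} \<Longrightarrow>
      \<sigma> *s partial_t T (u k) t x = partial_x l (partial_x l (u k)) t x - P x *v u k t x"
    and u_bc: "\<And>k t. t \<in> {0<..<T} \<Longrightarrow> partial_x l (u k) t 0 = 0"
    and v_eq: "\<And>k t x. t \<in> {0..T} \<Longrightarrow> x \<in> {0..l} \<Longrightarrow>
      \<sigma> *s partial_t T (v k) t x = partial_x l (partial_x l (v k)) t x - Q x *v v k t x"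
    and v_bc: "\<And>k t. t \<in> {0<..<T} \<Longrightarrow> partial_x l (v k) t 0 = 0"
    and det: "\<And>x. x \<in> {0..l} \<Longrightarrow> det (matrix_of_columns (\<lambda>k. u k \<tau> x)) \<noteq> 0"
    and uv\<tau>: "\<And>k x. x \<in> {0<..<l} \<Longrightarrow> u k \<tau> x = v k \<tau> x"
    and uv0: "\<And>k t. t \<in> {0<..<T} \<Longrightarrow> u k t 0 = v k t 0"
    and x: "x \<in> {0..l}"
  shows "P x = Q x"
proof -
  \<comment> \<open>Even reflections, frozen beyond \<open>l\<close>, provide coefficients
    continuous on the whole line that agree with the given ones on \<open>{0..l}\<close>.\<close>
  define P' where "P' y = mv (P (min \<bar>y\<bar> l))" for y
  define Q' where "Q' y = mv (Q (min \<bar>y\<bar> l))" for y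
  define J :: "(complex ^ 'n) \<Rightarrow>\<^sub>L (complex ^ 'n)" where "J = Blinfun (\<lambda>z. \<sigma> *s z)"
  have "linear (\<lambda>z::complex ^ 'n. \<sigma> *s z)"
    by (rule linearI) (simp_all add: vec_eq_iff algebra_simps)
  then have J: "blinfun_apply J z = \<sigma> *s z" for z
    unfolding J_def by (simp add: bounded_linear_Blinfun_apply linear_conv_bounded_linear)
  have cont: "continuous_on UNIV (\<lambda>y. mv (R (min \<bar>y\<bar> l)))" if "continuous_on {0..l} R" for R :: "real \<Rightarrow> complex ^ 'n ^ 'n"
    by (rule bounded_linear.continuous_on[OF bounded_linear_mv], rule continuous_on_compose2[OF that])
      (use \<open>l > 0\<close> in \<open>auto intro!: continuous_intros\<close>)
  interpret transmutation_J l P' Q' J T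
  proof
    show "continuous_on UNIV P'" "continuous_on UNIV Q'"
      unfolding P'_def Q'_def by (intro cont continuous_on_matrix_C1 P_C1 Q_C1)+
    show "J o\<^sub>L P' y = P' y o\<^sub>L J" "J o\<^sub>L Q' y = Q' y o\<^sub>L J" for y
      by (rule blinfun_eqI; simp add: P'_def Q'_def J vector_scalar_commute)+
  qed (use assms in \<open>auto simp: P'_def\<close>)
  have P': "P' y = mv (P y)" and Q': "Q' y = mv (Q y)" if "y \<in> {0..l}" for y
    using that by (auto simp: P'_def Q'_def)
  have C12u: "C12_derivs T l (u k) (partial_t T (u k)) (partial_x l (u k)) (partial_x l (partial_x l (u k)))"
    and C12v: "C12_derivs T l (v k) (partial_t T (v k)) (partial_x l (v k)) (partial_x l (partial_x l (v k)))" for k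
    using C12_derivs_vec[OF \<open>l > 0\<close> \<open>T > 0\<close>] u_C12 v_C12 by blast+
  \<comment> \<open>Independent of the point y: its norm goes into the constant, and
    \<open>norm (K y)\<close> remains as the only factor varying with y.\<close>
  define b where "b k = clamped l (reflect (partial_t T (u k) \<tau>))" for k
  have diff: "(Q y - P y) *v u k \<tau> y = - blinfun_apply J (blinfun_apply (K y) (b k))" if y: "y \<in> {0..l}" for k y
  proof -
    have "blinfun_apply (Q' y - P' y) (u k \<tau> y) = - blinfun_apply J (blinfun_apply (K y) (b k))"
      unfolding b_def
    proof (rule coefficient_difference[OF C12u C12v _ _ u_bc v_bc uv0 \<tau> uv\<tau> y])
      fix t y assume ty: "t \<in> {0..T}" "y \<in> {0..l}"
      show "blinfun_apply J (partial_t T (u k) t y) = partial_x l (partial_x l (u k)) t y - blinfun_apply (P' y) (u k t y)"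
        using u_eq[OF ty] by (simp add: J P'[OF ty(2)])
      show "blinfun_apply J (partial_t T (v k) t y) = partial_x l (partial_x l (v k)) t y - blinfun_apply (Q' y) (v k t y)"
        using v_eq[OF ty] by (simp add: J Q'[OF ty(2)])
    qed
    then show ?thesis by (simp add: P'[OF y] Q'[OF y] mv_diff)
  qed
  have "continuous_on {0..l} (\<lambda>x. u k \<tau> x)" for k
    using C12u[of k] \<tau> continuous_on_section_snd[of "{0..T}" "{0..l}" "u k" \<tau>] by (simp add: C12_derivs_def)
  then obtain c where c: "c \<ge> 0" "\<And>y (A :: complex ^ 'n ^ 'n). y \<in> {0..l} \<Longrightarrow> norm A \<le> c * (\<Sum>k\<in>UNIV. norm (A *v u k \<tau> y))"
    using columns_bound[of l "\<lambda>x k. u k \<tau> x"] det \<open>l > 0\<close> by (metis less_imp_le)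
  obtain m where m: "m > 0" "\<And>A :: complex ^ 'n ^ 'n. norm (mv A) \<le> norm A * m"
    using bounded_linear.pos_bounded[OF bounded_linear_mv] by blast
  have "Q' x = P' x"
  proof (rule coefficients_eq[OF _ x])
    fix y assume y: "y \<in> {0..l}"
    have "norm ((Q y - P y) *v u k \<tau> y) \<le> norm J * norm (b k) * norm (K y)" for k
    proof -
      have "norm ((Q y - P y) *v u k \<tau> y) \<le> norm J * norm (blinfun_apply (K y) (b k))"
        unfolding diff[OF y] norm_minus_cancel by (rule norm_blinfun)
      also have "\<dots> \<le> norm J * (norm (K y) * norm (b k))"
        by (intro mult_left_mono norm_blinfun norm_ge_zero)
      finally show ?thesis by (simp add: mult_ac)
    qed
    then have "(\<Sum>k\<in>UNIV. norm ((Q y - P y) *v u k \<tau> y)) \<le> (\<Sum>k\<in>UNIV. norm J * norm (b k) * norm (K y))"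
      by (intro sum_mono)
    then have "c * (\<Sum>k\<in>UNIV. norm ((Q y - P y) *v u k \<tau> y)) \<le> c * (\<Sum>k\<in>UNIV. norm J * norm (b k) * norm (K y))"
      using c(1) by (rule mult_left_mono)
    then have "norm (Q y - P y) \<le> c * (\<Sum>k\<in>UNIV. norm J * norm (b k) * norm (K y))"
      by (rule order_trans[OF c(2)[OF y]])
    then have "norm (Q y - P y) * m \<le> c * (\<Sum>k\<in>UNIV. norm J * norm (b k) * norm (K y)) * m"
      using m(1) by (intro mult_right_mono) auto
    then have "norm (mv (Q y - P y)) \<le> c * (\<Sum>k\<in>UNIV. norm J * norm (b k) * norm (K y)) * m"
      by (rule order_trans[OF m(2)])
    then show "norm (Q' y - P' y) \<le> m * c * (\<Sum>k\<in>UNIV. norm J * norm (b k)) * norm (K y)"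
      unfolding P'[OF y] Q'[OF y] mv_diff sum_distrib_right[symmetric] by (simp only: mult_ac)
  qed
  then have "Q x *v z = P x *v z" for z
    unfolding P'[OF x] Q'[OF x] by (metis mv_apply)
  then show ?thesis by (simp add: matrix_eq)
qed

theorem theorem1:
  fixes l T :: real and \<sigma> :: complex
    and P Q :: "real \<Rightarrow> complex ^ 'n ^ 'n"
    and u v :: "'n::finite \<Rightarrow> real \<Rightarrow> real \<Rightarrow> complex ^ 'n"
  assumes "l > 0" and "T > 0" and "\<sigma> \<noteq> 0"
    and P_C1: "\<And>i j. C1_interval l (\<lambda>x. P x $ i $ j)"
    and Q_C1: "\<And>i j. C1_interval l (\<lambda>x. Q x $ i $ j)"
    and u_C12: "\<And>k i. C12_rectangle T l (\<lambda>t x. u k t x $ i)"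
    and v_C12: "\<And>k i. C12_rectangle T l (\<lambda>t x. v k t x $ i)"
    and u_eq: "\<And>k t x. t \<in> {0..T} \<Longrightarrow> x \<in> {0..l} \<Longrightarrow>
      \<sigma> *s partial_t T (u k) t x = partial_x l (partial_x l (u k)) t x - P x *v u k t x"
    and u_bc: "\<And>k t. t \<in> {0<..<T} \<Longrightarrow> partial_x l (u k) t 0 = 0"
    and v_eq: "\<And>k t x. t \<in> {0..T} \<Longrightarrow> x \<in> {0..l} \<Longrightarrow>
      \<sigma> *s partial_t T (v k) t x = partial_x l (partial_x l (v k)) t x - Q x *v v k t x"
    and v_bc: "\<And>k t. t \<in> {0<..<T} \<Longrightarrow> partial_x l (v k) t 0 = 0"
  shows
    "((\<forall>x\<in>{0..l}. cmod (det (matrix_of_columns (\<lambda>k. u k 0 x))) > 0) \<longrightarrow>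
      (\<forall>k. \<forall>x\<in>{0<..<l}. u k 0 x = v k 0 x) \<longrightarrow>
      (\<forall>k. \<forall>t\<in>{0<..<T}. u k t 0 = v k t 0) \<longrightarrow>
      (\<forall>x\<in>{0..l}. P x = Q x)) \<and>
     ((\<forall>x\<in>{0..l}. cmod (det (matrix_of_columns (\<lambda>k. u k T x))) > 0) \<longrightarrow>
      (\<forall>k. \<forall>x\<in>{0<..<l}. u k T x = v k T x) \<longrightarrow>
      (\<forall>k. \<forall>t\<in>{0<..<T}. u k t 0 = v k t 0) \<longrightarrow>
      (\<forall>x\<in>{0..l}. P x = Q x))"
proof (intro conjI impI ballI)
  fix x assume x: "x \<in> {0..l}"
    and det: "\<forall>x\<in>{0..l}. cmod (det (matrix_of_columns (\<lambda>k. u k 0 x))) > 0"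
    and uv: "\<forall>k. \<forall>x\<in>{0<..<l}. u k 0 x = v k 0 x" "\<forall>k. \<forall>t\<in>{0<..<T}. u k t 0 = v k t 0"
  show "P x = Q x"
    by (rule coefficients_determined[where u = u and v = v and \<tau> = 0 and \<sigma> = \<sigma>,
        OF \<open>l > 0\<close> \<open>T > 0\<close> _ P_C1 Q_C1 u_C12 v_C12 u_eq u_bc v_eq v_bc _ _ _ x])
      (use \<open>T > 0\<close> det uv in auto)
next
  fix x assume x: "x \<in> {0..l}"
    and det: "\<forall>x\<in>{0..l}. cmod (det (matrix_of_columns (\<lambda>k. u k T x))) > 0"
    and uv: "\<forall>k. \<forall>x\<in>{0<..<l}. u k T x = v k T x" "\<forall>k. \<forall>t\<in>{0<..<T}. u k t 0 = v k t 0"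
  show "P x = Q x"
    by (rule coefficients_determined[where u = u and v = v and \<tau> = T and \<sigma> = \<sigma>,
        OF \<open>l > 0\<close> \<open>T > 0\<close> _ P_C1 Q_C1 u_C12 v_C12 u_eq u_bc v_eq v_bc _ _ _ x])
      (use \<open>T > 0\<close> det uv in auto)
qed

end
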